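(* Let $\overline{\sigma}>0$ and consider the $G$-Brownian motion $(B_t)_{t\ge0}$ in the degenerate case $\underline{\sigma}=0$. Then for each $T>0$ and each $A\in\mathcal B(\mathbb R)$ with $A\neq\emptyset$ and $A\neq\mathbb R$, we have $I_A(B_T)\notin L^1_G(\Omega)$.
   Context: Let $\Omega=C[0,\infty)$ be the space of real continuous paths $\omega$ with $\omega_0=0$, and $B_t(\omega)=\omega_t$ the canonical process. Let $\overline{\sigma}>0$, $\underline{\sigma}=0$, and $G(a)=\frac12\overline{\sigma}^2a^+$ for $a\in\mathbb{R}$. The $G$-expectation $\hat{\mathbb{E}}$ on $Lip(\Omega)=\{\varphi(B_{t_1},\dots,B_{t_n}-B_{t_{n-1}}):n\in\mathbb N,\ 0<t_1<\dots<t_n,\ \varphi$ bounded Lipschitz on $\mathbb R^n\}$ is defined by $\hat{\mathbb{E}}[\varphi(x+B_t-B_s)]=u(t-s,x)$, where $u$ is the viscosity solution of the $G$-heat equation $\partial_t u-G(\partial^2_{xx}u)=0$, $u(0,\cdot)=\varphi$, extended to several increments by iterated conditioning; $B$ is then called a $G$-Brownian motion. $L^1_G(\Omega)$ denotes the completion of $Lip(\Omega)$ under the norm $\|X\|_1=\hat{\mathbb E}[|X|]$, realized as a space of $\mathcal B(\Omega)$-measurable random variables identified up to quasi-sure equality, where quasi-sure is with respect to the capacity $c(D)=\sup_{P\in\mathcal P}P(D)$, $\mathcal P$ being the weak closure of the set of laws of $\int_0^\cdot v_s\,dW_s$ for a standard Brownian motion $W$ and adapted $v$ with values in $[0,\overline{\sigma}]$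 (equivalently, $L^1_G(\Omega)$ consists of those $\mathcal B(\Omega)$-measurable $X$ with $\lim_{N\to\infty}\sup_{P\in\mathcal P}E_P[|X|I_{\{|X|\ge N\}}]=0$ having a quasi-continuous version). $I_A$ denotes the indicator function of $A$. *)

theory Defs
  imports "HOL-Probability.Probability"
begin

type_synonym path = "real \<Rightarrow> real"

text \<open>Canonical space Omega = C[0,oo) with omega_0 = 0; paths are extended by 0 to t < 0
  so that each element of C[0,oo) has exactly one representative.\<close>
definition Omega :: "path set" where
  "Omega = {\<omega>. continuous_on {0..} \<omega> \<and> (\<forall>t\<le>0. \<omega> t = 0)}"

text \<open>Borel sigma-algebra of Omega (= sigma-algebra generated by the coordinates).\<close>
definition Omega_M :: "path measure" where
  "Omega_M = sigma Omega {{\<omega>\<in>Omega. \<omega> t \<in> U} | t U. 0 \<le> t \<and> U \<in> sets borel}"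

definition Filt :: "real \<Rightarrow> path measure" where
  "Filt s = sigma Omega {{\<omega>\<in>Omega. \<omega> t \<in> U} | t U. 0 \<le> t \<and> t \<le> s \<and> U \<in> sets borel}"

text \<open>Topology of uniform convergence on compacts (metric rho of the paper):
  basic neighbourhoods of omega.\<close>
definition nbhd :: "path \<Rightarrow> nat \<Rightarrow> real \<Rightarrow> path set" where
  "nbhd \<omega> n \<delta> = {\<omega>'\<in>Omega. \<forall>t\<in>{0..real n}. \<bar>\<omega>' t - \<omega> t\<bar> < \<delta>}"

definition Omega_open :: "path set \<Rightarrow> bool" where
  "Omega_open U \<longleftrightarrow> U \<subseteq> Omega \<and> (\<forall>\<omega>\<in>U. \<exists>n \<delta>. \<delta> > 0 \<and> nbhd \<omega> n \<delta> \<subseteq> U)"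

definition cont_on_Omega :: "path set \<Rightarrow> (path \<Rightarrow> real) \<Rightarrow> bool" where
  "cont_on_Omega F X \<longleftrightarrow> (\<forall>\<omega>\<in>F. \<forall>e>0. \<exists>n \<delta>. \<delta> > 0 \<and>
      (\<forall>\<omega>'\<in>F \<inter> nbhd \<omega> n \<delta>. \<bar>X \<omega>' - X \<omega>\<bar> < e))"

definition wiener :: "path measure \<Rightarrow> bool" where
  "wiener Q \<longleftrightarrow> prob_space Q \<and> sets Q = sets Omega_M \<and>
     (\<forall>s t. 0 \<le> s \<and> s < t \<longrightarrow>
        distributed Q lborel (\<lambda>\<omega>. \<omega> t - \<omega> s) (\<lambda>x. ennreal (normal_density 0 (sqrt (t - s)) x))) \<and>
     (\<forall>(ts :: nat \<Rightarrow> real) n. 0 \<le> ts 0 \<and> (\<forall>i<n. ts i < ts (Suc i)) \<longrightarrow>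
        prob_space.indep_vars Q (\<lambda>_. borel) (\<lambda>i \<omega>. \<omega> (ts (Suc i)) - \<omega> (ts i)) {..<n})"

text \<open>Stochastic integral int_0^. v dW of a simple integrand
  v = sum_k xi_k 1_{(ts k, ts (k+1)]}, pathwise.\<close>
definition stoch_int :: "(nat \<Rightarrow> path \<Rightarrow> real) \<Rightarrow> (nat \<Rightarrow> real) \<Rightarrow> nat \<Rightarrow> path \<Rightarrow> path" where
  "stoch_int \<xi> ts n \<omega> = (\<lambda>t. \<Sum>k<n. \<xi> k \<omega> * (\<omega> (min t (ts (Suc k))) - \<omega> (min t (ts k))))"

definition simple_laws :: "real \<Rightarrow> path measure set" where
  "simple_laws \<sigma> = {distr Q Omega_M (stoch_int \<xi> ts n) | Q \<xi> ts n.
      wiener Q \<and> 0 \<le> ts 0 \<and> (\<forall>k<n. ts k < ts (Suc k)) \<and>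
      (\<forall>k<n. \<xi> k \<in> borel_measurable (Filt (ts k)) \<and> (\<forall>\<omega>\<in>Omega. \<xi> k \<omega> \<in> {0..\<sigma>}))}"

definition bounded_cont_Omega :: "(path \<Rightarrow> real) \<Rightarrow> bool" where
  "bounded_cont_Omega f \<longleftrightarrow> cont_on_Omega Omega f \<and> (\<exists>K. \<forall>\<omega>\<in>Omega. \<bar>f \<omega>\<bar> \<le> K)"

definition weak_conv :: "(nat \<Rightarrow> path measure) \<Rightarrow> path measure \<Rightarrow> bool" where
  "weak_conv Pn P \<longleftrightarrow> (\<forall>f. bounded_cont_Omega f \<longrightarrow>
      (\<lambda>n. \<integral>\<omega>. f \<omega> \<partial>Pn n) \<longlonglongrightarrow> (\<integral>\<omega>. f \<omega> \<partial>P))"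

text \<open>The family \<P>: weak closure of simple_laws (the space of probability measures on a
  Polish space with the weak topology is metrizable, so sequential closure = closure).\<close>
definition PG :: "real \<Rightarrow> path measure set" where
  "PG \<sigma> = {P. prob_space P \<and> sets P = sets Omega_M \<and>
      (\<exists>Pn. (\<forall>n. Pn n \<in> simple_laws \<sigma>) \<and> weak_conv Pn P)}"

definition cap :: "real \<Rightarrow> path set \<Rightarrow> ennreal" where
  "cap \<sigma> D = (SUP P\<in>PG \<sigma>. emeasure P D)"

definition qs_null :: "real \<Rightarrow> path set \<Rightarrow> bool" where
  "qs_null \<sigma> N \<longleftrightarrow> (\<exists>N'\<in>sets Omega_M. N \<inter> Omega \<subseteq> N' \<and> cap \<sigma> N' = 0)"

definition quasi_continuous :: "real \<Rightarrow> (path \<Rightarrow> real) \<Rightarrow> bool" where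
  "quasi_continuous \<sigma> Y \<longleftrightarrow> (\<forall>\<epsilon>>0. \<exists>U. Omega_open U \<and> U \<in> sets Omega_M \<and>
      cap \<sigma> U < ennreal \<epsilon> \<and> cont_on_Omega (Omega - U) Y)"

definition L1G :: "real \<Rightarrow> (path \<Rightarrow> real) set" where
  "L1G \<sigma> = {X. X \<in> borel_measurable Omega_M \<and>
      (\<lambda>N::nat. SUP P\<in>PG \<sigma>. \<integral>\<^sup>+\<omega>. ennreal (\<bar>X \<omega>\<bar> * indicator {\<omega>. \<bar>X \<omega>\<bar> \<ge> real N} \<omega>) \<partial>P)
         \<longlonglongrightarrow> 0 \<and>
      (\<exists>Y. quasi_continuous \<sigma> Y \<and> qs_null \<sigma> {\<omega>. X \<omega> \<noteq> Y \<omega>})}"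

end

theory Submission
  imports Defs
begin

text \<open>
  Fix \<open>x\<close> with \<open>I_A(x) \<noteq> I_A(0)\<close>, let \<open>W\<close> be Brownian motion and \<open>Z\<close> be \<open>W\<close> stopped when it hits
  \<open>h = x / \<sigma>\<close> or at time \<open>T\<close>. Since the lower volatility is \<open>0\<close>, stopping is an admissible control, so
  the law of \<open>s \<sigma> Z\<close> belongs to \<open>P\<close> for every \<open>s \<in> [0,1]\<close>. On the event \<open>E\<close> that \<open>h\<close> is hit before \<open>T\<close>,
  which has positive probability, this path ends exactly at \<open>s x\<close>, and it depends continuously on \<open>s\<close>.
  By connectedness \<open>s \<mapsto> I_A(s x)\<close> is discontinuous at some \<open>t = lim r_n\<close>. If \<open>Y\<close> is a version of \<open>I_A(B_T)\<close>
  continuous off an open set \<open>U\<close> of small capacity, then with positive probability the path \<open>t \<sigma> Z\<close> and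
  infinitely many of the paths \<open>r_n \<sigma> Z\<close> avoid \<open>U\<close>, contradicting the continuity of \<open>Y\<close> there.

  The set \<open>P\<close> is empty unless Wiener measure exists. It is obtained by Levy's midpoint displacement, and
  the law of its increments is identified through joint characteristic functions.
\<close>

section \<open>Independence from joint characteristic functions\<close>

lemma iexp_integrable:
  assumes "prob_space M" and [measurable]: "X \<in> borel_measurable M"
  shows "integrable M (\<lambda>\<omega>. iexp (X \<omega>))"
  by (rule prob_space.integrable_iexp[OF assms(1)]) auto

lemma char_distr_eq:
  assumes [measurable]: "X \<in> borel_measurable M"
  shows "char (distr M borel X) u = (CLINT \<omega>|M. iexp (u * X \<omega>))"
  unfolding char_def by (rule integral_distr) auto

lemma char_minus: "char \<nu> (- u) = cnj (char \<nu> u)"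
  unfolding char_def by (subst Bochner_Integration.integral_cnj[symmetric]) (simp add: exp_cnj)

lemma distr_eq_of_char:
  assumes "prob_space M" and X[measurable]: "X \<in> borel_measurable M"
    and \<nu>: "real_distribution \<nu>"
    and "\<And>u. (CLINT \<omega>|M. iexp (u * X \<omega>)) = char \<nu> u"
  shows "distr M borel X = \<nu>"
proof (rule Levy_uniqueness)
  interpret prob_space M by fact
  show "real_distribution (distr M borel X)" by (rule real_distribution_distr) fact
  show "char (distr M borel X) = char \<nu>"
    using assms by (simp add: fun_eq_iff char_distr_eq)
qed fact

context prob_space
begin

text \<open>Reweighting by the positive density \<open>2 + cos (S + \<theta>)\<close> does not change the law of \<open>X\<close>, by Levy's
  uniqueness theorem for a single variable.\<close>
lemma integral_cos_indicator_eq: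
  fixes \<theta> :: real
  assumes [measurable]: "S \<in> borel_measurable M" "X \<in> borel_measurable M" "A \<in> sets borel"
    and \<nu>: "real_distribution \<nu>"
    and S: "\<And>u. (CLINT \<omega>|M. iexp (S \<omega> + u * X \<omega>)) = c * char \<nu> u"
    and X: "\<And>u. (CLINT \<omega>|M. iexp (u * X \<omega>)) = char \<nu> u"
  shows "(\<integral>\<omega>. cos (S \<omega> + \<theta>) * indicator A (X \<omega>) \<partial>M) = Re (iexp \<theta> * c) * measure \<nu> A"
proof -
  interpret \<nu>: real_distribution \<nu> by fact
  \<comment> \<open>The constant \<open>2\<close> keeps the weight at least \<open>1\<close>. Its
    mean \<open>q\<close> is found below by taking \<open>u = 0\<close>, where characteristic
    functions equal \<open>1\<close>.\<close>
  define f where "f \<omega> = 2 + cos (S \<omega> + \<theta>)" for \<omega>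
  define q where "q = 2 + Re (iexp \<theta> * c)"
  have f_ge: "1 \<le> f \<omega>" for \<omega>
    using cos_ge_minus_one[of "S \<omega> + \<theta>"] unfolding f_def by linarith
  have f_le: "\<bar>f \<omega>\<bar> \<le> 3" for \<omega>
    using cos_le_one[of "S \<omega> + \<theta>"] f_ge[of \<omega>] unfolding f_def by linarith
  have fm[measurable]: "f \<in> borel_measurable M" unfolding f_def by measurable
  have int: "integrable M (\<lambda>\<omega>. iexp (Y \<omega>))" if [measurable]: "Y \<in> borel_measurable M" for Y
    by (rule iexp_integrable) (auto simp: prob_space_axioms)
  have key: "(CLINT \<omega>|M. f \<omega> * iexp (u * X \<omega>)) = q * char \<nu> u" for u
  proof -
    have 1: "(CLINT \<omega>|M. iexp (S \<omega> + \<theta> + u * X \<omega>)) = iexp \<theta> * c * char \<nu> u" for u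
    proof -
      have "(CLINT \<omega>|M. iexp (S \<omega> + \<theta> + u * X \<omega>)) = (CLINT \<omega>|M. iexp \<theta> * iexp (S \<omega> + u * X \<omega>))"
        by (rule Bochner_Integration.integral_cong) (auto simp: exp_add[symmetric] algebra_simps)
      then show ?thesis using S[of u] by simp
    qed
    \<comment> \<open>The negative exponential of the cosine is the conjugate of the positive one at
      \<open>-u\<close>; \<open>char_minus\<close> then restores
      \<open>char \<nu> u\<close>.\<close>
    have "(CLINT \<omega>|M. iexp (- S \<omega> - \<theta> + u * X \<omega>)) = (CLINT \<omega>|M. cnj (iexp (S \<omega> + \<theta> + (-u) * X \<omega>)))"
      by (rule Bochner_Integration.integral_cong) (auto simp: exp_cnj algebra_simps)
    also have "\<dots> = cnj (CLINT \<omega>|M. iexp (S \<omega> + \<theta> + (-u) * X \<omega>))"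
      by (rule Bochner_Integration.integral_cnj)
    also have "\<dots> = cnj (iexp \<theta> * c) * char \<nu> u"
      by (subst 1) (simp add: char_minus)
    finally have 2: "(CLINT \<omega>|M. iexp (- S \<omega> - \<theta> + u * X \<omega>)) = cnj (iexp \<theta> * c) * char \<nu> u" .
    have "(CLINT \<omega>|M. f \<omega> * iexp (u * X \<omega>)) = (CLINT \<omega>|M. 2 * iexp (u * X \<omega>) +
        (iexp (S \<omega> + \<theta> + u * X \<omega>) + iexp (- S \<omega> - \<theta> + u * X \<omega>)) / 2)"
    proof (rule Bochner_Integration.integral_cong[OF refl])
      fix \<omega>
      have c: "complex_of_real (cos z) = (iexp z + iexp (- z)) / 2" for z
        by (simp add: cos_of_real[symmetric] cos_exp_eq)
      have e: "- S \<omega> - \<theta> + u * X \<omega> = - (S \<omega> + \<theta>) + u * X \<omega>" by simp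
      show "f \<omega> * iexp (u * X \<omega>) = 2 * iexp (u * X \<omega>) +
        (iexp (S \<omega> + \<theta> + u * X \<omega>) + iexp (- S \<omega> - \<theta> + u * X \<omega>)) / 2"
        unfolding f_def e of_real_add c distrib_left exp_add
        by (simp add: algebra_simps exp_minus add_divide_distrib)
    qed
    also have "\<dots> = 2 * char \<nu> u + (iexp \<theta> * c * char \<nu> u + cnj (iexp \<theta> * c) * char \<nu> u) / 2"
    proof -
      note i = int[of "\<lambda>\<omega>. u * X \<omega>"] int[of "\<lambda>\<omega>. S \<omega> + \<theta> + u * X \<omega>"] int[of "\<lambda>\<omega>. - S \<omega> - \<theta> + u * X \<omega>"]
      show ?thesis
        using i by (simp add: X 1 2 del: of_real_add of_real_mult of_real_diff of_real_minus)
    qed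
    also have "\<dots> = q * char \<nu> u"
    proof -
      have "(iexp \<theta> * c * char \<nu> u + cnj (iexp \<theta> * c) * char \<nu> u) = (iexp \<theta> * c + cnj (iexp \<theta> * c)) * char \<nu> u"
        by (rule distrib_right[symmetric])
      then show ?thesis
        unfolding complex_add_cnj q_def by (simp add: distrib_right)
    qed
    finally show ?thesis .
  qed
  have intf: "integrable M (\<lambda>\<omega>. f \<omega> * g \<omega>)" if [measurable]: "g \<in> borel_measurable M" and "\<And>\<omega>. \<bar>g \<omega>\<bar> \<le> 1" for g
  proof (rule integrable_const_bound[where B=3])
    show "AE \<omega> in M. norm (f \<omega> * g \<omega>) \<le> 3"
      using mult_mono[OF f_le that(2)] by (simp add: abs_mult)
  qed measurable
  have Ef: "(\<integral>\<omega>. f \<omega> \<partial>M) = q"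
  proof -
    have "(CLINT \<omega>|M. complex_of_real (f \<omega>)) = complex_of_real q"
      using key[of 0] \<nu>.char_zero by simp
    then show ?thesis by (simp only: integral_complex_of_real of_real_eq_iff)
  qed
  have q1: "q \<ge> 1"
    using integral_mono[of M "\<lambda>_. 1" f] intf[of "\<lambda>_. 1"] f_ge Ef prob_space by simp
  define M' where "M' = density M (\<lambda>\<omega>. ennreal (f \<omega> / q))"
  have [measurable_cong]: "sets M' = sets M" by (simp add: M'_def)
  have fq: "0 \<le> f \<omega> / q" for \<omega> using f_ge[of \<omega>] q1 by simp
  have "emeasure M' (space M') = ennreal (\<integral>\<omega>. f \<omega> / q \<partial>M)"
    using fq intf[of "\<lambda>_. 1"] unfolding M'_def
    by (simp add: emeasure_density nn_integral_eq_integral)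
  then have M': "prob_space M'"
    using Ef q1 by (intro prob_spaceI) simp
  have "distr M' borel X = \<nu>"
  proof (rule distr_eq_of_char[OF M' _ \<nu>])
    fix u
    have "(CLINT \<omega>|M'. iexp (u * X \<omega>)) = (CLINT \<omega>|M. (f \<omega> * iexp (u * X \<omega>)) / q)"
      unfolding M'_def by (subst integral_density) (use fq in \<open>auto simp: scaleR_conv_of_real\<close>)
    also have "\<dots> = char \<nu> u"
      using key[of u] q1 by simp
    finally show "(CLINT \<omega>|M'. iexp (u * X \<omega>)) = char \<nu> u" .
  qed auto
  then have "measure \<nu> A = measure (distr M' borel X) A" by simp
  also have "\<dots> = (\<integral>\<omega>. indicator A (X \<omega>) \<partial>M')"
    using M' by (subst integral_distr[symmetric, where N=borel]) (auto intro!: integral_indicator[symmetric])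
  also have "\<dots> = (\<integral>\<omega>. f \<omega> * indicator A (X \<omega>) \<partial>M) / q"
    unfolding M'_def by (subst integral_density) (use fq in auto)
  finally have 1: "(\<integral>\<omega>. f \<omega> * indicator A (X \<omega>) \<partial>M) = q * measure \<nu> A"
    using q1 by (simp add: field_simps)
  \<comment> \<open>The law of \<open>X\<close> under \<open>M\<close> itself is also
    \<open>\<nu>\<close>, so the contribution of the constant \<open>2\<close> in \<open>f\<close>
    can be subtracted exactly.\<close>
  have "distr M borel X = \<nu>"
    by (rule distr_eq_of_char[OF prob_space_axioms _ \<nu> X]) auto
  then have "measure \<nu> A = measure (distr M borel X) A" by simp
  also have "\<dots> = (\<integral>\<omega>. indicator A (X \<omega>) \<partial>M)"
    by (subst integral_distr[symmetric, where N=borel]) (auto intro!: integral_indicator[symmetric])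
  finally have 2: "measure \<nu> A = (\<integral>\<omega>. indicator A (X \<omega>) \<partial>M)" .
  have "(\<integral>\<omega>. cos (S \<omega> + \<theta>) * indicator A (X \<omega>) \<partial>M) =
      (\<integral>\<omega>. f \<omega> * indicator A (X \<omega>) - 2 * indicator A (X \<omega>) \<partial>M)"
    by (rule Bochner_Integration.integral_cong) (auto simp: f_def algebra_simps)
  also have "\<dots> = q * measure \<nu> A - 2 * measure \<nu> A"
  proof (subst Bochner_Integration.integral_diff)
    show "integrable M (\<lambda>\<omega>. f \<omega> * indicator A (X \<omega>))" by (rule intf) (auto simp: indicator_def)
    have "integrable M (\<lambda>\<omega>. indicator A (X \<omega>) :: real)"
      by (rule integrable_const_bound[where B=1]) (auto simp: indicator_def)
    then show "integrable M (\<lambda>\<omega>. 2 * indicator A (X \<omega>) :: real)" by simp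
  qed (simp add: 1 flip: 2)
  finally show ?thesis by (simp add: q_def algebra_simps)
qed

text \<open>The phases \<open>0\<close> and \<open>- pi / 2\<close> in the cosine identity give the
  real and the imaginary part.\<close>

lemma integral_iexp_indicator_eq:
  assumes [measurable]: "S \<in> borel_measurable M" "X \<in> borel_measurable M" "A \<in> sets borel"
    and \<nu>: "real_distribution \<nu>"
    and S: "\<And>u. (CLINT \<omega>|M. iexp (S \<omega> + u * X \<omega>)) = c * char \<nu> u"
    and X: "\<And>u. (CLINT \<omega>|M. iexp (u * X \<omega>)) = char \<nu> u"
  shows "(CLINT \<omega>|M. iexp (S \<omega>) * indicator A (X \<omega>)) = c * measure \<nu> A"
proof -
  have int: "integrable M (\<lambda>\<omega>. iexp (S \<omega>) * indicator A (X \<omega>))"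
    by (rule integrable_const_bound[where B=1]) (auto simp: norm_mult indicator_def)
  note * = integral_cos_indicator_eq[OF assms(1-3) \<nu> S X]
  have re: "Re (iexp (S \<omega>) * indicator A (X \<omega>)) = cos (S \<omega>) * indicator A (X \<omega>)"
    and im: "Im (iexp (S \<omega>) * indicator A (X \<omega>)) = sin (S \<omega>) * indicator A (X \<omega>)" for \<omega>
    by (auto simp: Re_exp Im_exp indicator_def)
  have cosd: "cos (x + - (pi / 2)) = sin x" for x :: real
    using cos_minus[of "pi / 2 - x"] by (simp add: sin_cos_eq)
  have "Re (CLINT \<omega>|M. iexp (S \<omega>) * indicator A (X \<omega>)) = Re (c * measure \<nu> A)"
    using *[of 0] by (subst integral_Re[OF int, symmetric]) (simp only: re, simp)
  moreover have "Im (CLINT \<omega>|M. iexp (S \<omega>) * indicator A (X \<omega>)) = Im (c * measure \<nu> A)"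
    using *[of "- (pi / 2)"] by (subst integral_Im[OF int, symmetric])
      (simp only: im cosd, simp add: Re_exp Im_exp)
  ultimately show ?thesis by (simp add: complex_eq_iff)
qed

end

text \<open>Conditioning on the last coordinate preserves the factorised joint characteristic function
  of the others, so the claim follows by induction on the dimension.\<close>
lemma prob_rectangle_of_char:
  fixes X :: "nat \<Rightarrow> 'a \<Rightarrow> real" and \<nu> :: "nat \<Rightarrow> real measure"
  assumes "prob_space M" and "\<And>i. i < n \<Longrightarrow> X i \<in> borel_measurable M"
    and \<nu>: "\<And>i. i < n \<Longrightarrow> real_distribution (\<nu> i)"
    and "\<And>u. (CLINT \<omega>|M. iexp (\<Sum>i<n. u i * X i \<omega>)) = (\<Prod>i<n. char (\<nu> i) (u i))"
    and "\<And>i. i < n \<Longrightarrow> A i \<in> sets borel"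
  shows "measure M {\<omega>\<in>space M. \<forall>i<n. X i \<omega> \<in> A i} = (\<Prod>i<n. measure (\<nu> i) (A i))"
  using assms
proof (induction n arbitrary: M)
  case 0
  then show ?case by (simp add: prob_space.prob_space)
next
  case (Suc n)
  interpret prob_space M by fact
  have Xm[measurable]: "X i \<in> borel_measurable M" if "i \<le> n" for i using Suc.prems(2) that by simp
  have Am[measurable]: "A i \<in> sets borel" if "i \<le> n" for i using Suc.prems(5) that by simp
  have char0: "char (\<nu> i) 0 = 1" if "i \<le> n" for i
    using real_distribution.char_zero Suc.prems(3) that by simp
  let ?E = "{\<omega>\<in>space M. X n \<omega> \<in> A n}"
  have [measurable]: "?E \<in> sets M" by simp
  \<comment> \<open>A coefficient vector supported on the last index leaves only its own factor, the
    others being characteristic functions at \<open>0\<close>.\<close>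
  have Xn: "(CLINT \<omega>|M. iexp (u * X n \<omega>)) = char (\<nu> n) u" for u
    using Suc.prems(4)[of "\<lambda>i. if i = n then u else 0"] by (simp add: char0)
  have Xn_law: "measure M ?E = measure (\<nu> n) (A n)"
  proof -
    have "distr M borel (X n) = \<nu> n"
      by (rule distr_eq_of_char[OF prob_space_axioms _ _ Xn]) (auto simp: Suc.prems)
    moreover have "measure (distr M borel (X n)) (A n) = measure M ?E"
      by (subst measure_distr) (auto simp: vimage_def Int_def conj_commute)
    ultimately show ?thesis by simp
  qed
  let ?F = "{\<omega>\<in>space M. \<forall>i<Suc n. X i \<omega> \<in> A i}"
  have [measurable]: "{\<omega>\<in>space M. \<forall>i<n. X i \<omega> \<in> A i} \<in> sets M"
    by measurable
  show ?case
  \<comment> \<open>If \<open>?E\<close> is null, both sides vanish; otherwise \<open>M'\<close>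
    below is \<open>M\<close> conditioned on \<open>?E\<close>.\<close>
  proof (cases "measure M ?E = 0")
    case True
    have "measure M ?F \<le> measure M ?E"
      by (rule finite_measure_mono) (auto simp: \<open>?E \<in> sets M\<close>)
    then have "measure M ?F = 0" using True measure_nonneg[of M ?F] by simp
    then show ?thesis using True Xn_law by simp
  next
    case False
    let ?p = "measure M ?E"
    have p: "?p > 0" using False measure_nonneg[of M ?E] by linarith
    define M' where "M' = density M (\<lambda>\<omega>. ennreal (indicator ?E \<omega> / ?p))"
    have s[measurable_cong]: "sets M' = sets M" by (simp add: M'_def)
    have sp: "space M' = space M" by (simp add: M'_def)
    have meas: "measure M' B = measure M (?E \<inter> B) / ?p" if [measurable]: "B \<in> sets M" for B
    proof -
      have "emeasure M' B = (\<integral>\<^sup>+\<omega>. ennreal (1 / ?p) * indicator (?E \<inter> B) \<omega> \<partial>M)"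
        unfolding M'_def
        by (subst emeasure_density) (auto intro!: nn_integral_cong simp: indicator_def)
      also have "\<dots> = ennreal (1 / ?p) * emeasure M (?E \<inter> B)"
        by (subst nn_integral_cmult) auto
      also have "\<dots> = ennreal (measure M (?E \<inter> B) / ?p)"
        using p by (simp add: emeasure_eq_measure ennreal_mult'[symmetric])
      finally show ?thesis using p by (simp add: measure_def)
    qed
    have M': "prob_space M'"
    proof (rule prob_spaceI)
      have "emeasure M' (space M') = (\<integral>\<^sup>+\<omega>. ennreal (1 / ?p) * indicator ?E \<omega> \<partial>M)"
        unfolding M'_def
        by (simp add: emeasure_density) (auto intro!: nn_integral_cong simp: indicator_def)
      also have "\<dots> = ennreal (1 / ?p) * emeasure M ?E"
        by (subst nn_integral_cmult) auto
      also have "\<dots> = 1"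
        using p by (simp add: emeasure_eq_measure ennreal_mult'[symmetric])
      finally show "emeasure M' (space M') = 1" .
    qed
    have "measure M' {\<omega>\<in>space M'. \<forall>i<n. X i \<omega> \<in> A i} = (\<Prod>i<n. measure (\<nu> i) (A i))"
    proof (rule Suc.IH[OF M'])
      fix u
      have "(CLINT \<omega>|M'. iexp (\<Sum>i<n. u i * X i \<omega>)) =
          (CLINT \<omega>|M. (iexp (\<Sum>i<n. u i * X i \<omega>) * indicator (A n) (X n \<omega>)) / ?p)"
        unfolding M'_def using p
        apply (subst integral_density)
           apply (auto simp: scaleR_conv_of_real intro!: Bochner_Integration.integral_cong)
        apply (auto simp: indicator_def)
        done
      also have "\<dots> = (CLINT \<omega>|M. iexp (\<Sum>i<n. u i * X i \<omega>) * indicator (A n) (X n \<omega>)) / ?p"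
        by simp
      also have "(CLINT \<omega>|M. iexp (\<Sum>i<n. u i * X i \<omega>) * indicator (A n) (X n \<omega>)) =
          (\<Prod>i<n. char (\<nu> i) (u i)) * measure (\<nu> n) (A n)"
      proof (rule integral_iexp_indicator_eq[OF _ _ _ _ _ Xn])
        fix v
        show "(CLINT \<omega>|M. iexp ((\<Sum>i<n. u i * X i \<omega>) + v * X n \<omega>)) = (\<Prod>i<n. char (\<nu> i) (u i)) * char (\<nu> n) v"
          using Suc.prems(4)[of "u(n := v)"] by simp
      qed (use Suc.prems in auto)
      finally show "(CLINT \<omega>|M'. iexp (\<Sum>i<n. u i * X i \<omega>)) = (\<Prod>i<n. char (\<nu> i) (u i))"
        using p Xn_law by simp
    qed (use Suc.prems in \<open>auto simp: measurable_cong_sets[OF s refl]\<close>)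
    then have "measure M (?E \<inter> {\<omega>\<in>space M. \<forall>i<n. X i \<omega> \<in> A i}) = (\<Prod>i<n. measure (\<nu> i) (A i)) * ?p"
      using p by (simp add: sp meas field_simps)
    also have "?E \<inter> {\<omega>\<in>space M. \<forall>i<n. X i \<omega> \<in> A i} = ?F"
      by (auto simp: less_Suc_eq)
    finally show ?thesis using Xn_law by simp
  qed
qed

text \<open>Independence can be tested on rectangles, where the product formula is known with the
  measures \<open>\<nu> i\<close>. Rectangles with a single nontrivial side identify these as the
  marginals of \<open>X\<close>.\<close>

lemma indep_vars_of_char:
  fixes X :: "nat \<Rightarrow> 'a \<Rightarrow> real" and \<nu> :: "nat \<Rightarrow> real measure"
  assumes "prob_space M" and Xm: "\<And>i. i < n \<Longrightarrow> X i \<in> borel_measurable M"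
    and \<nu>: "\<And>i. i < n \<Longrightarrow> real_distribution (\<nu> i)"
    and X: "\<And>u. (CLINT \<omega>|M. iexp (\<Sum>i<n. u i * X i \<omega>)) = (\<Prod>i<n. char (\<nu> i) (u i))"
  shows "prob_space.indep_vars M (\<lambda>_. borel) X {..<n}"
proof -
  interpret prob_space M by fact
  show ?thesis
  \<comment> \<open>The criterion \<open>indep_vars_finite\<close> asks for a nonempty index
    set.\<close>
  proof (cases "n = 0")
    case True
    then show ?thesis by (simp add: indep_vars_def2 indep_sets_def)
  next
    case False
    have single: "measure M (X i -` B \<inter> space M) = measure (\<nu> i) B" if "i < n" "B \<in> sets borel" for i B
    proof -
      have one: "measure (\<nu> j) UNIV = 1" if "j < n" for j
      proof -
        interpret \<nu>: real_distribution "\<nu> j" using \<nu> that by simp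
        show ?thesis using \<nu>.prob_space by simp
      qed
      have "{\<omega>\<in>space M. \<forall>j<n. X j \<omega> \<in> (if j = i then B else UNIV)} = X i -` B \<inter> space M"
        using that(1) by auto
      moreover have "(\<Prod>j<n. measure (\<nu> j) (if j = i then B else UNIV)) = (\<Prod>j<n. if j = i then measure (\<nu> i) B else 1)"
        by (intro prod.cong) (auto simp: one)
      ultimately show ?thesis
        using prob_rectangle_of_char[OF assms(1) Xm \<nu> X, of "\<lambda>j. if j = i then B else UNIV"] that
        by (simp only: prod.delta finite_lessThan lessThan_iff if_True) auto
    qed
    have "indep_vars (\<lambda>_. borel) X {..<n} \<longleftrightarrow>
      (\<forall>A\<in>(\<Pi> i\<in>{..<n}. sets borel). prob (\<Inter>j\<in>{..<n}. X j -` A j \<inter> space M) = (\<Prod>j\<in>{..<n}. prob (X j -` A j \<inter> space M)))"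
    proof (rule indep_vars_finite)
      show "sets (borel :: real measure) = sigma_sets (space borel) (sets borel)"
        by (rule sets.sigma_sets_eq[symmetric])
    qed (use False Xm in \<open>auto simp: Int_stable_def\<close>)
    also have "\<dots>"
    proof
      fix A assume A: "A \<in> (\<Pi> i\<in>{..<n}. sets (borel :: real measure))"
      have "(\<Inter>j\<in>{..<n}. X j -` A j \<inter> space M) = {\<omega>\<in>space M. \<forall>i<n. X i \<omega> \<in> A i}"
        using False by auto
      then show "prob (\<Inter>j\<in>{..<n}. X j -` A j \<inter> space M) = (\<Prod>j\<in>{..<n}. prob (X j -` A j \<inter> space M))"
        using prob_rectangle_of_char[OF assms(1) Xm \<nu> X, of A] A single by (auto simp only: Pi_iff lessThan_iff intro!: prod.cong)
    qed
    finally show ?thesis .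
  qed
qed

section \<open>Brownian paths by midpoint displacement\<close>

text \<open>\<open>levy_incr g m k\<close> is the increment of the path over \<open>[k / 2 ^ m, (k + 1) / 2 ^ m]\<close>. Given its value, the
  two half increments arise by adding and subtracting an independent Gaussian of the same variance.\<close>
fun levy_incr :: "(nat \<times> nat \<Rightarrow> real) \<Rightarrow> nat \<Rightarrow> nat \<Rightarrow> real" where
  "levy_incr g 0 k = g (0, k)"
| "levy_incr g (Suc m) j =
    (levy_incr g m (j div 2) + (if even j then 1 else - 1) * sqrt (1/2) ^ m * g (Suc m, j div 2)) / 2"

text \<open>The profile of one linear interpolation piece, from \<open>0\<close> to \<open>1\<close>
  over a unit step.\<close>

definition clamp01 :: "real \<Rightarrow> real" where "clamp01 y = max 0 (min 1 y)"

text \<open>The Schauder hat function on the unit interval, with peak \<open>1\<close> at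
  \<open>1/2\<close>, written through the profiles of the two half steps.\<close>

definition tent :: "real \<Rightarrow> real" where "tent y = clamp01 (2 * y) - clamp01 (2 * y - 1)"

text \<open>Piecewise linear interpolation of the partial sums of \<open>levy_incr g m\<close>.\<close>
definition levy_approx :: "(nat \<times> nat \<Rightarrow> real) \<Rightarrow> nat \<Rightarrow> real \<Rightarrow> real" where
  "levy_approx g m t = (\<Sum>k<nat \<lceil>2 ^ m * t\<rceil>. levy_incr g m k * clamp01 (2 ^ m * t - real k))"

text \<open>The positions \<open>k < n * 2 ^ n\<close> are the level \<open>n\<close> intervals
  inside \<open>[0, n]\<close>. The base \<open>5/4\<close> is below the square root of
  \<open>2\<close>, which makes the corrections summable, while \<open>(5/4) ^ 8 > 4\<close> makes
  the event almost sure.\<close>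

definition levy_good :: "(nat \<times> nat \<Rightarrow> real) \<Rightarrow> bool" where
  "levy_good g \<longleftrightarrow> (\<exists>n0. \<forall>n\<ge>n0. \<forall>k<n * 2 ^ n. \<bar>g (Suc n, k)\<bar> \<le> (5/4) ^ n)"

text \<open>The zero path off the good event makes every sample, not just almost every one, an
  element of \<open>Omega\<close>.\<close>

definition levy_path :: "(nat \<times> nat \<Rightarrow> real) \<Rightarrow> real \<Rightarrow> real" where
  "levy_path g = (if levy_good g then (\<lambda>t. lim (\<lambda>m. levy_approx g m t)) else (\<lambda>_. 0))"

lemma clamp01_simps: "y \<le> 0 \<Longrightarrow> clamp01 y = 0" "1 \<le> y \<Longrightarrow> clamp01 y = 1"
  by (auto simp: clamp01_def)

lemma clamp01_double: "(clamp01 (2 * y) + clamp01 (2 * y - 1)) / 2 = clamp01 y"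
  by (auto simp: clamp01_def max_def min_def)

lemma tent_eq_0: "y \<le> 0 \<or> 1 \<le> y \<Longrightarrow> tent y = 0"
  by (auto simp: tent_def clamp01_def max_def min_def)

lemma tent_bounds: "0 \<le> tent y" "tent y \<le> 1"
  by (auto simp: tent_def clamp01_def max_def min_def)

lemma continuous_clamp01 [continuous_intros]:
  "continuous_on S f \<Longrightarrow> continuous_on S (\<lambda>x. clamp01 (f x))"
  unfolding clamp01_def by (intro continuous_intros)

text \<open>The additional terms vanish because their pieces begin at or after \<open>t\<close>.
  This allows one summation range for all times in a bounded set and for consecutive levels.\<close>

lemma levy_approx_eq:
  assumes "2 ^ m * t \<le> real K"
  shows "levy_approx g m t = (\<Sum>k<K. levy_incr g m k * clamp01 (2 ^ m * t - real k))"
  unfolding levy_approx_def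
proof (rule sum.mono_neutral_left)
  show "{..<nat \<lceil>2 ^ m * t\<rceil>} \<subseteq> {..<K}"
    using assms by (auto simp: zless_nat_eq_int_zless less_ceiling_iff)
  show "\<forall>k\<in>{..<K} - {..<nat \<lceil>2 ^ m * t\<rceil>}. levy_incr g m k * clamp01 (2 ^ m * t - real k) = 0"
  proof
    fix k assume "k \<in> {..<K} - {..<nat \<lceil>2 ^ m * t\<rceil>}"
    then have "2 ^ m * t \<le> real k" by (auto simp: not_less nat_le_iff ceiling_le_iff)
    then show "levy_incr g m k * clamp01 (2 ^ m * t - real k) = 0" by (simp add: clamp01_simps)
  qed
qed simp

lemma sum_pairs: "(\<Sum>j<2 * K. f j) = (\<Sum>k<K. f (2 * k) + f (2 * k + 1 :: nat))"
  for f :: "nat \<Rightarrow> 'a :: comm_monoid_add"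
  by (induction K) (auto simp: ac_simps)

text \<open>Pairing the two halves of each interval, the common part of their increments reproduces
  the old linear piece by \<open>clamp01_double\<close>, and the part of alternating sign leaves a
  tent.\<close>

lemma levy_approx_Suc_diff:
  assumes "2 ^ m * t \<le> real K"
  shows "levy_approx g (Suc m) t - levy_approx g m t =
    (\<Sum>k<K. (sqrt (1/2) ^ m * g (Suc m, k) / 2) * tent (2 ^ m * t - real k))"
proof -
  have "levy_approx g (Suc m) t = (\<Sum>j<2 * K. levy_incr g (Suc m) j * clamp01 (2 ^ Suc m * t - real j))"
    by (rule levy_approx_eq) (use assms in auto)
  also have "\<dots> = (\<Sum>k<K. levy_incr g (Suc m) (2 * k) * clamp01 (2 ^ Suc m * t - real (2 * k)) +
     levy_incr g (Suc m) (2 * k + 1) * clamp01 (2 ^ Suc m * t - real (2 * k + 1)))"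
    by (rule sum_pairs)
  finally have 1: "levy_approx g (Suc m) t = \<dots>" .
  show ?thesis
    unfolding 1 levy_approx_eq[OF assms] sum_subtractf[symmetric]
  proof (rule sum.cong[OF refl])
    fix k
    define y where "y = 2 ^ m * t - real k"
    have y: "2 ^ Suc m * t - real (2 * k) = 2 * y" "2 ^ Suc m * t - real (2 * k + 1) = 2 * y - 1"
      by (simp_all add: y_def)
    show "levy_incr g (Suc m) (2 * k) * clamp01 (2 ^ Suc m * t - real (2 * k)) +
       levy_incr g (Suc m) (2 * k + 1) * clamp01 (2 ^ Suc m * t - real (2 * k + 1)) -
       levy_incr g m k * clamp01 (2 ^ m * t - real k) =
       (sqrt (1/2) ^ m * g (Suc m, k) / 2) * tent (2 ^ m * t - real k)"
      unfolding y y_def[symmetric] clamp01_double[of y, symmetric] tent_def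
      by (simp add: field_simps)
  qed
qed

text \<open>Shifted tents overlap at most at endpoints, where they vanish, so at each
  \<open>x\<close> at most one term survives.\<close>

lemma abs_sum_tent_le:
  assumes "\<And>k. k < K \<Longrightarrow> \<bar>a k\<bar> \<le> c" "0 \<le> c"
  shows "\<bar>\<Sum>k<K. a k * tent (x - real k)\<bar> \<le> c"
  using assms(1)
proof (induction K)
  case 0
  then show ?case using assms by simp
next
  case (Suc K)
  show ?case
  proof (cases "x \<le> real K")
    case True
    then show ?thesis using Suc by (simp add: tent_eq_0)
  next
    case False
    then have "(\<Sum>k<K. a k * tent (x - real k)) = 0"
      by (intro sum.neutral) (auto intro!: tent_eq_0)
    moreover have "\<bar>a K\<bar> * tent (x - real K) \<le> c * 1"
      using Suc.prems[of K] tent_bounds assms by (intro mult_mono) auto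
    ultimately show ?thesis using tent_bounds by (simp add: abs_mult)
  qed
qed

lemma levy_approx_dyadic: "levy_approx g m (real k / 2 ^ m) = (\<Sum>j<k. levy_incr g m j)"
  by (subst levy_approx_eq[where K=k]) (auto intro!: sum.cong simp: clamp01_simps)

text \<open>The corrections of level \<open>m\<close> and beyond vanish at the level
  \<open>m\<close> dyadic points, so the approximations are stationary there.\<close>

lemma levy_approx_dyadic_const:
  assumes "m \<le> n"
  shows "levy_approx g n (real k / 2 ^ m) = (\<Sum>j<k. levy_incr g m j)"
  using assms
proof (induction n rule: dec_induct)
  case base
  then show ?case by (rule levy_approx_dyadic)
next
  case (step n)
  \<comment> \<open>The point is a whole number of level \<open>n\<close> steps, so every tent
    argument below is an integer and at least \<open>1\<close>.\<close>
  have e: "2 ^ n * (real k / 2 ^ m) = real (k * 2 ^ (n - m))"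
    using step.hyps power_add[of "2::real" m "n - m"] by simp
  have "levy_approx g (Suc n) (real k / 2 ^ m) - levy_approx g n (real k / 2 ^ m) =
    (\<Sum>j<k * 2 ^ (n - m). (sqrt (1/2) ^ n * g (Suc n, j) / 2) * tent (2 ^ n * (real k / 2 ^ m) - real j))"
    by (rule levy_approx_Suc_diff) (simp only: e)
  also have "\<dots> = 0"
  proof (rule sum.neutral, rule ballI)
    fix j assume "j \<in> {..<k * 2 ^ (n - m)}"
    then have "1 \<le> real (k * 2 ^ (n - m)) - real j"
      unfolding of_nat_diff[symmetric] by (auto simp del: of_nat_mult simp flip: of_nat_diff)
    then show "(sqrt (1/2) ^ n * g (Suc n, j) / 2) * tent (2 ^ n * (real k / 2 ^ m) - real j) = 0"
      unfolding e by (simp add: tent_eq_0)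
  qed
  finally show ?case using step by simp
qed

lemma levy_approx_nonpos: "t \<le> 0 \<Longrightarrow> levy_approx g m t = 0"
  by (subst levy_approx_eq[where K=0]) (auto simp: mult_nonneg_nonpos)

lemma continuous_levy_approx: "continuous_on {..real N} (levy_approx g m)"
proof -
  have "continuous_on {..real N} (\<lambda>t. \<Sum>k<N * 2 ^ m. levy_incr g m k * clamp01 (2 ^ m * t - real k))"
    by (intro continuous_intros)
  moreover have "levy_approx g m t = (\<Sum>k<N * 2 ^ m. levy_incr g m k * clamp01 (2 ^ m * t - real k))"
    if "t \<in> {..real N}" for t
    by (rule levy_approx_eq) (use that in \<open>auto simp: mult.commute\<close>)
  ultimately show ?thesis using continuous_on_cong by (metis (no_types, lifting))
qed

text \<open>Weierstrass M-test for the telescoping series of corrections, which on the good event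
  are eventually dominated by a geometric sequence, since
  \<open>sqrt (1/2) * (5/4) < 1\<close>.\<close>

lemma levy_approx_uniformly_convergent:
  assumes "levy_good g"
  shows "uniformly_convergent_on {..real N} (levy_approx g)"
proof -
  from assms obtain n0 where n0: "\<And>n k. n0 \<le> n \<Longrightarrow> k < n * 2 ^ n \<Longrightarrow> \<bar>g (Suc n, k)\<bar> \<le> (5/4) ^ n"
    by (auto simp: levy_good_def)
  define r where "r = sqrt (1/2) * (5/4 :: real)"
  have "(5/4)\<^sup>2 * (1/2) < (1::real)" by (simp add: power2_eq_square)
  then have "sqrt ((5/4)\<^sup>2 * (1/2)) < sqrt 1" by (rule real_sqrt_less_mono)
  then have r: "0 \<le> r" "r < 1" by (simp_all only: r_def real_sqrt_mult real_sqrt_abs real_sqrt_one) (auto simp: mult.commute)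
  \<comment> \<open>\<open>N \<le> n\<close> places all intervals meeting \<open>[0, N]\<close>
    among the positions controlled by \<open>levy_good\<close> at level \<open>n\<close>.\<close>
  have bound: "norm (levy_approx g (Suc n) t - levy_approx g n t) \<le> r ^ n"
    if n: "max n0 N \<le> n" and t: "t \<in> {..real N}" for n t
  proof -
    have "2 ^ n * t \<le> 2 ^ n * real N" using t by simp
    then have le: "2 ^ n * t \<le> real (N * 2 ^ n)" by (simp add: mult.commute)
    have "\<bar>\<Sum>k<N * 2 ^ n. (sqrt (1/2) ^ n * g (Suc n, k) / 2) * tent (2 ^ n * t - real k)\<bar> \<le> r ^ n"
    proof (rule abs_sum_tent_le)
      fix k assume "k < N * 2 ^ n"
      also have "\<dots> \<le> n * 2 ^ n" using n by simp
      finally have "\<bar>g (Suc n, k)\<bar> \<le> (5/4) ^ n" using n by (intro n0) auto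
      then have "sqrt (1/2) ^ n * \<bar>g (Suc n, k)\<bar> / 2 \<le> sqrt (1/2) ^ n * (5/4) ^ n / 1"
        by (intro frac_le mult_left_mono) auto
      moreover have "r ^ n = sqrt (1/2) ^ n * (5/4) ^ n"
        unfolding r_def by (rule power_mult_distrib)
      ultimately show "\<bar>sqrt (1/2) ^ n * g (Suc n, k) / 2\<bar> \<le> r ^ n"
        by (simp add: abs_mult)
    qed (use r in simp)
    then show ?thesis by (simp add: levy_approx_Suc_diff[OF le])
  qed
  have "uniformly_convergent_on {..real N} (\<lambda>n t. \<Sum>i<n. levy_approx g (Suc i) t - levy_approx g i t)"
  proof (rule Weierstrass_m_test'_ev)
    show "\<forall>\<^sub>F n in sequentially. \<forall>t\<in>{..real N}. norm (levy_approx g (Suc n) t - levy_approx g n t) \<le> r ^ n"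
      using eventually_ge_at_top[of "max n0 N"] by eventually_elim (use bound in blast)
    show "summable (\<lambda>n. r ^ n)" using r by simp
  qed
  then have "uniformly_convergent_on {..real N} (\<lambda>n t. levy_approx g 0 t + (\<Sum>i<n. levy_approx g (Suc i) t - levy_approx g i t))"
    by (intro uniformly_convergent_add) (auto simp: uniformly_convergent_on_def intro: uniform_limit_const)
  moreover have "levy_approx g 0 t + (\<Sum>i<n. levy_approx g (Suc i) t - levy_approx g i t) = levy_approx g n t" for n t
    using sum_lessThan_telescope[of "\<lambda>i. levy_approx g i t" n] by simp
  ultimately show ?thesis by simp
qed

lemma levy_path_eq: "levy_good g \<Longrightarrow> levy_path g t = lim (\<lambda>m. levy_approx g m t)"
  by (simp add: levy_path_def)

lemma levy_path_nonpos: "t \<le> 0 \<Longrightarrow> levy_path g t = 0"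
  by (simp add: levy_path_def levy_approx_nonpos)

lemma continuous_levy_path: "continuous_on UNIV (levy_path g)"
proof (cases "levy_good g")
  case True
  have "continuous_on {..real N} (levy_path g)" for N
  proof (rule uniform_limit_theorem)
    show "uniform_limit {..real N} (levy_approx g) (levy_path g) sequentially"
      using levy_approx_uniformly_convergent[OF True, of N]
      by (simp add: uniformly_convergent_uniform_limit_iff levy_path_eq[OF True, abs_def])
  qed (auto intro: continuous_levy_approx always_eventually)
  \<comment> \<open>Open half lines are used because continuity glues over unions of open
    sets.\<close>
  then have "continuous_on {..<real N} (levy_path g)" for N
    by (rule continuous_on_subset[of "{..real N}"]) auto
  then have "continuous_on (\<Union>N\<in>UNIV. {..<real N}) (levy_path g)"
    by (intro continuous_on_open_UN open_lessThan)
  also have "(\<Union>N\<in>UNIV. {..<real N}) = UNIV"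
    using reals_Archimedean2 by auto
  finally show ?thesis .
next
  case False
  then show ?thesis by (simp add: levy_path_def)
qed

lemma levy_path_in_Omega: "levy_path g \<in> Omega"
  using continuous_levy_path by (auto simp: Omega_def levy_path_nonpos intro: continuous_on_subset)

lemma levy_path_dyadic:
  assumes "levy_good g"
  shows "levy_path g (real k / 2 ^ m) = (\<Sum>j<k. levy_incr g m j)"
  unfolding levy_path_eq[OF assms]
  by (rule limI, rule tendsto_eventually)
     (auto simp: eventually_sequentially intro!: exI[of _ m] levy_approx_dyadic_const)

section \<open>Independent standard normals: law of the dyadic increments and tail bounds\<close>

definition gauss_seq :: "(nat \<times> nat \<Rightarrow> real) measure" where
  "gauss_seq = PiM UNIV (\<lambda>_. std_normal_distribution)"

interpretation gauss_seq: prob_space gauss_seq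
  unfolding gauss_seq_def by (rule prob_space_PiM) (simp add: prob_space_normal_density)

lemma space_gauss_seq [simp]: "space gauss_seq = UNIV"
  by (simp add: gauss_seq_def space_PiM)

lemma measurable_gauss_seq_component [measurable]: "(\<lambda>g. g i) \<in> borel_measurable gauss_seq"
  unfolding gauss_seq_def
  using measurable_component_singleton[of i UNIV "\<lambda>_. std_normal_distribution"] by simp

lemma distr_gauss_seq_component: "distr gauss_seq borel (\<lambda>g. g i) = std_normal_distribution"
proof -
  have "distr gauss_seq std_normal_distribution (\<lambda>g. g i) = std_normal_distribution"
    unfolding gauss_seq_def
    by (rule distr_PiM_component) (auto simp: prob_space_normal_density)
  moreover have "distr gauss_seq std_normal_distribution (\<lambda>g. g i) = distr gauss_seq borel (\<lambda>g. g i)"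
    by (rule distr_cong) auto
  ultimately show ?thesis by simp
qed

lemma indep_gauss_seq: "gauss_seq.indep_vars (\<lambda>_. borel) (\<lambda>i g. g i) B"
proof -
  have "gauss_seq.indep_vars (\<lambda>_. borel) (\<lambda>i g. g i) UNIV"
  proof (subst gauss_seq.indep_vars_iff_distr_eq_PiM)
    show "distr gauss_seq (PiM UNIV (\<lambda>_. borel)) (\<lambda>x. \<lambda>i\<in>UNIV. x i) =
        PiM UNIV (\<lambda>i. distr gauss_seq borel (\<lambda>g. g i))"
      unfolding distr_gauss_seq_component gauss_seq_def[symmetric]
      unfolding gauss_seq_def restrict_UNIV
      by (rule distr_id2) (auto intro!: sets_PiM_cong)
  qed auto
  then show ?thesis by (rule gauss_seq.indep_vars_subset) simp
qed

lemma char_gauss_seq: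
  assumes "finite B"
  shows "(CLINT g|gauss_seq. iexp (\<Sum>i\<in>B. e i * g i)) = exp (- (\<Sum>i\<in>B. (e i)\<^sup>2) / 2)"
proof -
  have "(CLINT g|gauss_seq. iexp (\<Sum>i\<in>B. e i * g i)) = char (distr gauss_seq borel (\<lambda>g. \<Sum>i\<in>B. e i * g i)) 1"
    by (simp add: char_distr_eq)
  also have "\<dots> = (\<Prod>i\<in>B. char (distr gauss_seq borel (\<lambda>g. e i * g i)) 1)"
    by (intro gauss_seq.char_distr_sum gauss_seq.indep_vars_compose2[OF indep_gauss_seq]) auto
  also have "\<dots> = (\<Prod>i\<in>B. complex_of_real (exp (- (e i)\<^sup>2 / 2)))"
  proof (rule prod.cong[OF refl])
    fix i
    have "char (distr gauss_seq borel (\<lambda>g. e i * g i)) 1 = char (distr gauss_seq borel (\<lambda>g. g i)) (e i)"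
      by (simp add: char_distr_eq)
    then show "char (distr gauss_seq borel (\<lambda>g. e i * g i)) 1 = complex_of_real (exp (- (e i)\<^sup>2 / 2))"
      by (simp add: distr_gauss_seq_component char_std_normal_distribution)
  qed
  also have "\<dots> = exp (- (\<Sum>i\<in>B. (e i)\<^sup>2) / 2)"
    using assms by (simp add: exp_sum[symmetric] sum_negf sum_divide_distrib flip: of_real_prod exp_of_real)
  finally show ?thesis .
qed

text \<open>The extra sum over deeper levels makes the induction on the level go through: one refinement step
  is an orthogonal change of coordinates, absorbed into the coefficients.\<close>
lemma char_levy_incr_aux:
  assumes "finite B" "\<And>i. i \<in> B \<Longrightarrow> m < fst i"
  shows "(CLINT g|gauss_seq. iexp ((\<Sum>k<2 ^ m * K. c k * levy_incr g m k) + (\<Sum>i\<in>B. e i * g i))) =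
    exp (- ((\<Sum>k<2 ^ m * K. (c k)\<^sup>2) / 2 ^ m + (\<Sum>i\<in>B. (e i)\<^sup>2)) / 2)"
  using assms
proof (induction m arbitrary: c e B)
  case 0
  \<comment> \<open>At level \<open>0\<close> the increments are coordinates themselves, distinct
    from those in \<open>B\<close> by the level condition.\<close>
  let ?B = "B \<union> Pair 0 ` {..<K}"
  define e' where "e' i = (if fst i = 0 then c (snd i) else e i)" for i
  have disj: "B \<inter> Pair 0 ` {..<K} = {}" using 0 by fastforce
  have "e' i = e i" if "i \<in> B" for i using 0(2)[OF that] by (simp add: e'_def)
  then have eB: "(\<Sum>i\<in>B. f (e' i) i) = (\<Sum>i\<in>B. f (e i) i)" for f :: "real \<Rightarrow> nat \<times> nat \<Rightarrow> real"
    by (intro sum.cong) auto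
  have S: "(\<Sum>i\<in>?B. f (e' i) i) = (\<Sum>k<K. f (c k) (0, k)) + (\<Sum>i\<in>B. f (e i) i)" for f :: "real \<Rightarrow> nat \<times> nat \<Rightarrow> real"
  proof -
    have "(\<Sum>i\<in>Pair 0 ` {..<K}. f (e' i) i) = (\<Sum>k<K. f (c k) (0, k))"
      by (simp add: sum.reindex inj_on_def e'_def)
    then show ?thesis using 0(1) disj by (simp add: sum.union_disjoint eB)
  qed
  show ?case
    using char_gauss_seq[of ?B e'] 0(1) S[of "\<lambda>a i. a * g i" for g] S[of "\<lambda>a i. a\<^sup>2"] by simp
next
  case (Suc m)
  let ?K = "2 ^ m * K"
  let ?B = "B \<union> Pair (Suc m) ` {..<?K}"
  \<comment> \<open>After inserting the recursion, \<open>c'\<close> is the coefficient of the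
    parent increment and \<open>d\<close> that of the new Gaussian, which joins \<open>B\<close> in
    the induction hypothesis.\<close>
  define c' where "c' k = (c (2 * k) + c (2 * k + 1)) / 2" for k
  define d where "d k = (c (2 * k) - c (2 * k + 1)) / 2 * sqrt (1/2) ^ m" for k
  define e' where "e' i = (if fst i = Suc m then d (snd i) else e i)" for i
  have disj: "B \<inter> Pair (Suc m) ` {..<?K} = {}" using Suc(3) by fastforce
  have "e' i = e i" if "i \<in> B" for i using Suc(3)[OF that] by (simp add: e'_def)
  then have eB: "(\<Sum>i\<in>B. f (e' i) i) = (\<Sum>i\<in>B. f (e i) i)" for f :: "real \<Rightarrow> nat \<times> nat \<Rightarrow> real"
    by (intro sum.cong) auto
  have S: "(\<Sum>i\<in>?B. f (e' i) i) = (\<Sum>k<?K. f (d k) (Suc m, k)) + (\<Sum>i\<in>B. f (e i) i)" for f :: "real \<Rightarrow> nat \<times> nat \<Rightarrow> real"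
  proof -
    have "(\<Sum>i\<in>Pair (Suc m) ` {..<?K}. f (e' i) i) = (\<Sum>k<?K. f (d k) (Suc m, k))"
      by (simp add: sum.reindex inj_on_def e'_def)
    then show ?thesis using Suc(2) disj by (simp add: sum.union_disjoint eB)
  qed
  have lin: "(\<Sum>k<2 ^ Suc m * K. c k * levy_incr g (Suc m) k) =
      (\<Sum>k<?K. c' k * levy_incr g m k) + (\<Sum>k<?K. d k * g (Suc m, k))" for g
  proof -
    have "(\<Sum>k<2 * ?K. c k * levy_incr g (Suc m) k) = (\<Sum>k<?K. c' k * levy_incr g m k + d k * g (Suc m, k))"
      unfolding sum_pairs by (intro sum.cong) (auto simp: c'_def d_def field_simps)
    then show ?thesis by (simp add: sum.distrib mult.assoc)
  qed
  \<comment> \<open>The variance is preserved by the parallelogram identity: the squares of the half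
    sum and the half difference add up to half the sum of the squares.\<close>
  have sq: "(\<Sum>k<2 ^ Suc m * K. (c k)\<^sup>2) / 2 ^ Suc m = (\<Sum>k<?K. (c' k)\<^sup>2) / 2 ^ m + (\<Sum>k<?K. (d k)\<^sup>2)"
  proof -
    have s: "(sqrt (1/2) ^ m)\<^sup>2 = 1 / 2 ^ m"
      by (simp add: power_divide real_sqrt_divide flip: power_mult power_even_eq)
         (metis power_mult_distrib real_sqrt_pow2 zero_le_numeral power2_eq_square mult.commute power_mult)
    have "(\<Sum>k<2 * ?K. (c k)\<^sup>2) / 2 ^ Suc m = (\<Sum>k<?K. (c' k)\<^sup>2 / 2 ^ m + (d k)\<^sup>2)"
      unfolding sum_pairs sum_divide_distrib
    proof (rule sum.cong[OF refl])
      fix k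
      have "(d k)\<^sup>2 = ((c (2 * k) - c (2 * k + 1)) / 2)\<^sup>2 / 2 ^ m"
        unfolding d_def power_mult_distrib s by simp
      then show "((c (2 * k))\<^sup>2 + (c (2 * k + 1))\<^sup>2) / 2 ^ Suc m = (c' k)\<^sup>2 / 2 ^ m + (d k)\<^sup>2"
        by (simp add: c'_def field_simps power2_eq_square)
    qed
    then show ?thesis by (simp add: sum.distrib mult.assoc sum_divide_distrib)
  qed
  have "(CLINT g|gauss_seq. iexp ((\<Sum>k<?K. c' k * levy_incr g m k) + (\<Sum>i\<in>?B. e' i * g i))) =
    exp (- ((\<Sum>k<?K. (c' k)\<^sup>2) / 2 ^ m + (\<Sum>i\<in>?B. (e' i)\<^sup>2)) / 2)"
    using Suc(2,3) by (intro Suc.IH) (auto dest: Suc_lessD)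
  then show ?case
    unfolding lin sq S[of "\<lambda>a i. a * g i" for g] S[of "\<lambda>a i. a\<^sup>2"] by (simp only: add.assoc)
qed

lemma measurable_levy_incr [measurable]: "(\<lambda>g. levy_incr g m k) \<in> borel_measurable gauss_seq"
  by (induction m arbitrary: k) auto

text \<open>Padding the coefficients with zeros gives the length \<open>2 ^ m * K\<close> of the
  auxiliary lemma. The result says that the increments are independent centred Gaussians of variance
  \<open>1 / 2 ^ m\<close>.\<close>

lemma char_levy_incr:
  "(CLINT g|gauss_seq. iexp (\<Sum>k<K. c k * levy_incr g m k)) = exp (- ((\<Sum>k<K. (c k)\<^sup>2) / 2 ^ m) / 2)"
proof -
  define c' where "c' k = (if k < K then c k else 0)" for k
  have sub: "{..<K} \<subseteq> {..<2 ^ m * K}" by auto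
  have S: "(\<Sum>k<2 ^ m * K. f (c' k) k) = (\<Sum>k<K. f (c k) k)" if "\<And>k. f 0 k = 0" for f :: "real \<Rightarrow> nat \<Rightarrow> real"
    by (rule sum.mono_neutral_cong_right) (use sub that in \<open>auto simp: c'_def\<close>)
  show ?thesis
    using char_levy_incr_aux[of "{}" m c' K "\<lambda>_. 0"]
    using S[of "\<lambda>a k. a * levy_incr g m k" for g] S[of "\<lambda>a k. a\<^sup>2"] by simp
qed

text \<open>Markov's inequality for the eighth moment, which is
  \<open>7 * 5 * 3 = 105\<close>.\<close>

lemma prob_gauss_seq_large:
  assumes "0 < a"
  shows "measure gauss_seq {g. a < \<bar>g i\<bar>} \<le> 105 / a ^ 8"
proof -
  have mom: "(\<integral>g. (g i) ^ 8 \<partial>gauss_seq) = 105"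
  proof -
    have "(\<integral>g. (g i) ^ 8 \<partial>gauss_seq) = (\<integral>x. x ^ 8 \<partial>distr gauss_seq borel (\<lambda>g. g i))"
      by (rule integral_distr[symmetric]) auto
    then show ?thesis
      using std_normal_distribution_even_moments(1)[of 4]
      by (simp add: distr_gauss_seq_component fact_numeral)
  qed
  \<comment> \<open>A function that is not integrable has integral \<open>0\<close> by default, so
    the value \<open>105\<close> forces integrability.\<close>
  have int: "integrable gauss_seq (\<lambda>g. (g i) ^ 8)"
    using mom not_integrable_integral_eq by fastforce
  have "measure gauss_seq {g. a < \<bar>g i\<bar>} \<le> measure gauss_seq {g\<in>space gauss_seq. a ^ 8 \<le> (g i) ^ 8}"
  proof (rule gauss_seq.finite_measure_mono)
    show "{g. a < \<bar>g i\<bar>} \<subseteq> {g\<in>space gauss_seq. a ^ 8 \<le> (g i) ^ 8}"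
    proof safe
      fix g :: "nat \<times> nat \<Rightarrow> real" assume "a < \<bar>g i\<bar>"
      then have "a ^ 8 \<le> \<bar>g i\<bar> ^ 8" using assms by (intro power_mono) auto
      then show "a ^ 8 \<le> (g i) ^ 8" by (simp add: power_even_abs)
    qed simp
    show "{g\<in>space gauss_seq. a ^ 8 \<le> (g i) ^ 8} \<in> sets gauss_seq" by measurable
  qed
  also have "\<dots> \<le> (\<integral>g. (g i) ^ 8 \<partial>gauss_seq) / a ^ 8"
    by (rule integral_Markov_inequality_measure[OF int]) (use assms in auto)
  finally show ?thesis by (simp add: mom)
qed

lemma levy_good_measurable [measurable]: "Measurable.pred gauss_seq levy_good"
  unfolding levy_good_def by measurable

text \<open>Borel-Cantelli with a union bound over the positions. Estimating \<open>n\<close> by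
  \<open>2 ^ n\<close> leaves a geometric series of ratio \<open>4 / (5/4) ^ 8\<close>, which is
  below \<open>1\<close>; this is the reason for the eighth moment.\<close>

lemma AE_levy_good: "AE g in gauss_seq. levy_good g"
proof -
  define A where "A n = {g :: nat \<times> nat \<Rightarrow> real. \<exists>k<n * 2 ^ n. (5/4) ^ n < \<bar>g (Suc n, k)\<bar>}" for n
  have A_eq: "A n = (\<Union>k<n * 2 ^ n. {g. (5/4) ^ n < \<bar>g (Suc n, k)\<bar>})" for n by (auto simp: A_def)
  have [measurable]: "{g. (5/4) ^ n < \<bar>g (Suc n, k)\<bar>} \<in> sets gauss_seq" for n k
  proof -
    have "{g\<in>space gauss_seq. (5/4) ^ n < \<bar>g (Suc n, k)\<bar>} \<in> sets gauss_seq" by measurable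
    then show ?thesis by simp
  qed
  have [measurable]: "A n \<in> sets gauss_seq" for n
    unfolding A_eq by (intro sets.finite_UN) auto
  have "AE g in gauss_seq. \<forall>\<^sub>F n in sequentially. g \<in> space gauss_seq - A n"
  proof (rule borel_cantelli_AE1)
    have r: "(4 / (5/4) ^ 8 :: real) < 1" by (simp add: power_numeral_reduce)
    have le: "measure gauss_seq (A n) \<le> 105 * (4 / (5/4) ^ 8) ^ n" for n
    proof -
      have "measure gauss_seq (A n) \<le> (\<Sum>k<n * 2 ^ n. measure gauss_seq {g. (5/4) ^ n < \<bar>g (Suc n, k)\<bar>})"
        unfolding A_eq by (rule gauss_seq.finite_measure_subadditive_finite) auto
      also have "\<dots> \<le> (\<Sum>k<n * 2 ^ n. 105 / ((5/4) ^ n) ^ 8)"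
        by (intro sum_mono prob_gauss_seq_large) simp
      also have "\<dots> = real n * 2 ^ n * (105 / ((5/4) ^ n) ^ 8)" by simp
      also have "\<dots> \<le> 2 ^ n * 2 ^ n * (105 / ((5/4) ^ n) ^ 8)"
        by (intro mult_right_mono) (auto simp: less_imp_le of_nat_less_two_power)
      also have "\<dots> = 105 * (4 / (5/4) ^ 8) ^ n"
      proof -
        have "((5/4) ^ n) ^ 8 = (((5/4) ^ 8) ^ n :: real)"
          by (simp only: power_mult[symmetric] mult.commute)
        moreover have "2 ^ n * 2 ^ n = (4 ^ n :: real)"
          by (simp flip: power_mult_distrib)
        ultimately show ?thesis by (simp only: power_divide times_divide_eq_right mult.commute)
      qed
      finally show ?thesis .
    qed
    show "summable (\<lambda>n. measure gauss_seq (A n))"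
      by (rule summable_comparison_test'[where g="\<lambda>n. 105 * (4 / (5/4) ^ 8) ^ n"])
         (use r le in \<open>auto intro!: summable_mult summable_geometric\<close>)
  qed (auto simp: gauss_seq.emeasure_eq_measure)
  then show ?thesis
  proof eventually_elim
    case (elim g)
    then obtain n0 where n0: "\<And>n. n0 \<le> n \<Longrightarrow> g \<notin> A n"
      by (auto simp: eventually_sequentially)
    show ?case
      unfolding levy_good_def
    proof (intro exI[of _ n0] allI impI)
      fix n k assume "n0 \<le> n" "k < n * 2 ^ n"
      then show "\<bar>g (Suc n, k)\<bar> \<le> (5/4) ^ n"
        using n0[of n] unfolding A_def mem_Collect_eq by (meson not_less)
    qed
  qed
qed

lemma measurable_levy_approx [measurable]: "(\<lambda>g. levy_approx g m t) \<in> borel_measurable gauss_seq"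
  unfolding levy_approx_def by measurable

lemma measurable_levy_path_at: "(\<lambda>g. levy_path g t) \<in> borel_measurable gauss_seq"
proof -
  have "(\<lambda>g. levy_path g t) = (\<lambda>g. if levy_good g then lim (\<lambda>m. levy_approx g m t) else 0)"
    by (auto simp: levy_path_def)
  then show ?thesis by simp
qed

section \<open>Gaussian law of the increments of the limit path\<close>

lemma real_distribution_normal:
  "0 < \<delta> \<Longrightarrow> real_distribution (density lborel (\<lambda>x. ennreal (normal_density 0 (sqrt \<delta>) x)))"
  using prob_space_normal_density[of "sqrt \<delta>" 0]
  by (auto simp: real_distribution_def real_distribution_axioms_def)

lemma char_normal:
  assumes "0 < \<delta>"
  shows "char (density lborel (\<lambda>x. ennreal (normal_density 0 (sqrt \<delta>) x))) u = exp (- (\<delta> * u\<^sup>2) / 2)"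
proof -
  interpret N: prob_space std_normal_distribution by (simp add: prob_space_normal_density)
  have "distributed std_normal_distribution lborel (\<lambda>x. x) std_normal_density"
    unfolding distributed_def by (auto intro!: distr_id2)
  from N.normal_density_affine[OF this, of "sqrt \<delta>" 0]
  have "distr std_normal_distribution lborel (\<lambda>x. sqrt \<delta> * x) = density lborel (\<lambda>x. ennreal (normal_density 0 (sqrt \<delta>) x))"
    using assms by (simp add: distributed_def)
  moreover have "distr std_normal_distribution lborel (\<lambda>x. sqrt \<delta> * x) = distr std_normal_distribution borel (\<lambda>x. sqrt \<delta> * x)"
    by (rule distr_cong) auto
  ultimately have "char (density lborel (\<lambda>x. ennreal (normal_density 0 (sqrt \<delta>) x))) u =
      (CLINT x|std_normal_distribution. iexp (u * (sqrt \<delta> * x)))"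
    using char_distr_eq[of "\<lambda>x. sqrt \<delta> * x" std_normal_distribution u] by simp
  also have "\<dots> = char std_normal_distribution (u * sqrt \<delta>)"
    by (simp add: char_def mult.assoc)
  finally show ?thesis
    using assms by (simp add: char_std_normal_distribution power_mult_distrib mult.commute)
qed

text \<open>Differences of partial sums are sums over disjoint consecutive blocks, so
  \<open>c\<close> is the step function with value \<open>u i\<close> on the block from
  \<open>a i\<close> to \<open>a (Suc i)\<close> and \<open>0\<close> before
  \<open>a 0\<close>.\<close>

lemma block_sum_coefficients:
  fixes a :: "nat \<Rightarrow> nat" and u :: "nat \<Rightarrow> real"
  assumes "\<And>i. i < n \<Longrightarrow> a i \<le> a (Suc i)"
  shows "\<exists>c. (\<forall>f :: nat \<Rightarrow> real. (\<Sum>i<n. u i * ((\<Sum>j<a (Suc i). f j) - (\<Sum>j<a i. f j))) = (\<Sum>j<a n. c j * f j)) \<and>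
    (\<Sum>j<a n. (c j)\<^sup>2) = (\<Sum>i<n. (u i)\<^sup>2 * (real (a (Suc i)) - real (a i)))"
  using assms
proof (induction n)
  case 0
  show ?case by (rule exI[of _ "\<lambda>_. 0"]) simp
next
  case (Suc n)
  then obtain c where c: "\<And>f :: nat \<Rightarrow> real. (\<Sum>i<n. u i * ((\<Sum>j<a (Suc i). f j) - (\<Sum>j<a i. f j))) = (\<Sum>j<a n. c j * f j)"
    "(\<Sum>j<a n. (c j)\<^sup>2) = (\<Sum>i<n. (u i)\<^sup>2 * (real (a (Suc i)) - real (a i)))"
    using Suc.IH[OF Suc.prems] less_SucI by auto
  define c' where "c' j = (if j < a n then c j else u n)" for j
  have le: "a n \<le> a (Suc n)" using Suc.prems by simp
  have split: "(\<Sum>j<a (Suc n). h j) = (\<Sum>j<a n. h j) + (\<Sum>j\<in>{a n..<a (Suc n)}. h j)" for h :: "nat \<Rightarrow> real"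
    using sum.atLeastLessThan_concat[of 0 "a n" "a (Suc n)" h] le by (simp add: atLeast0LessThan)
  have 1: "(\<Sum>j<a n. c' j * f j) = (\<Sum>j<a n. c j * f j)" "(\<Sum>j<a n. (c' j)\<^sup>2) = (\<Sum>j<a n. (c j)\<^sup>2)" for f
    by (auto simp: c'_def)
  have 2: "(\<Sum>j\<in>{a n..<a (Suc n)}. c' j * f j) = u n * (\<Sum>j\<in>{a n..<a (Suc n)}. f j)"
      "(\<Sum>j\<in>{a n..<a (Suc n)}. (c' j)\<^sup>2) = (u n)\<^sup>2 * (real (a (Suc n)) - real (a n))" for f
    using le by (auto simp: c'_def sum_distrib_left of_nat_diff)
  show ?case
  proof (intro exI[of _ c'] conjI allI)
    fix f :: "nat \<Rightarrow> real"
    show "(\<Sum>i<Suc n. u i * ((\<Sum>j<a (Suc i). f j) - (\<Sum>j<a i. f j))) = (\<Sum>j<a (Suc n). c' j * f j)"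
      using split[of f] split[of "\<lambda>j. c' j * f j"] by (simp only: sum.lessThan_Suc c 1 2) simp
    show "(\<Sum>j<a (Suc n). (c' j)\<^sup>2) = (\<Sum>i<Suc n. (u i)\<^sup>2 * (real (a (Suc i)) - real (a i)))"
      using split[of "\<lambda>j. (c' j)\<^sup>2"] by (simp only: sum.lessThan_Suc c 1 2)
  qed
qed

lemma dyadic_floor_tendsto:
  assumes "0 \<le> t"
  shows "(\<lambda>m. real (nat \<lfloor>2 ^ m * t\<rfloor>) / 2 ^ m) \<longlonglongrightarrow> t"
proof -
  have "(\<lambda>m. real (nat \<lfloor>2 ^ m * t\<rfloor>) / 2 ^ m - t) \<longlonglongrightarrow> 0"
  proof (rule Lim_null_comparison)
    show "\<forall>\<^sub>F m in sequentially. norm (real (nat \<lfloor>2 ^ m * t\<rfloor>) / 2 ^ m - t) \<le> (1/2) ^ m"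
    proof (rule always_eventually, rule allI)
      fix m :: nat
      have "real (nat \<lfloor>2 ^ m * t\<rfloor>) = of_int \<lfloor>2 ^ m * t\<rfloor>" using assms by simp
      then have "\<bar>real (nat \<lfloor>2 ^ m * t\<rfloor>) - 2 ^ m * t\<bar> \<le> 1" by linarith
      then have "\<bar>real (nat \<lfloor>2 ^ m * t\<rfloor>) - 2 ^ m * t\<bar> / 2 ^ m \<le> 1 / 2 ^ m"
        by (rule divide_right_mono) simp
      also have "\<bar>real (nat \<lfloor>2 ^ m * t\<rfloor>) - 2 ^ m * t\<bar> / 2 ^ m = \<bar>real (nat \<lfloor>2 ^ m * t\<rfloor>) / 2 ^ m - t\<bar>"
      proof -
        have "real (nat \<lfloor>2 ^ m * t\<rfloor>) / 2 ^ m - t = (real (nat \<lfloor>2 ^ m * t\<rfloor>) - 2 ^ m * t) / 2 ^ m"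
          by (simp add: diff_divide_distrib)
        then show ?thesis by (simp only: abs_divide) simp
      qed
      finally show "norm (real (nat \<lfloor>2 ^ m * t\<rfloor>) / 2 ^ m - t) \<le> (1/2) ^ m"
        by (simp add: power_one_over)
    qed
    show "(\<lambda>m. (1/2 :: real) ^ m) \<longlonglongrightarrow> 0" by (rule LIMSEQ_realpow_zero) auto
  qed
  then show ?thesis by (rule LIM_zero_cancel)
qed

text \<open>At dyadic times the increments are block sums of \<open>levy_incr\<close>, so the
  formula is exact. Rounding the times down to level \<open>m\<close> and letting \<open>m\<close>
  grow gives the general case by path continuity and dominated convergence.\<close>

lemma char_levy_path_increments:
  assumes "0 \<le> ts 0" "\<And>i. i < n \<Longrightarrow> ts i < ts (Suc i)"
  shows "(CLINT g|gauss_seq. iexp (\<Sum>i<n. u i * (levy_path g (ts (Suc i)) - levy_path g (ts i)))) =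
    exp (- (\<Sum>i<n. (u i)\<^sup>2 * (ts (Suc i) - ts i)) / 2)"
proof -
  have pos: "0 \<le> ts i" if "i \<le> n" for i
    using that
  proof (induction i)
    case (Suc i)
    then show ?case using assms(2)[of i] by simp
  qed (use assms in simp)
  define a where "a m i = nat \<lfloor>2 ^ m * ts i\<rfloor>" for m i
  define L where "L m g = (\<Sum>i<n. u i * (levy_path g (real (a m (Suc i)) / 2 ^ m) - levy_path g (real (a m i) / 2 ^ m)))" for m g
  have [measurable]: "(\<lambda>g. levy_path g t) \<in> borel_measurable gauss_seq" for t
    by (rule measurable_levy_path_at)
  have Lm [measurable]: "L m \<in> borel_measurable gauss_seq" for m
    unfolding L_def by measurable
  have a_lim: "(\<lambda>m. real (a m i) / 2 ^ m) \<longlonglongrightarrow> ts i" if "i \<le> n" for i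
    unfolding a_def by (rule dyadic_floor_tendsto) (use pos that in auto)
  have E: "(CLINT g|gauss_seq. iexp (L m g)) =
      exp (- (\<Sum>i<n. (u i)\<^sup>2 * (real (a m (Suc i)) / 2 ^ m - real (a m i) / 2 ^ m)) / 2)" for m
  proof -
    have "a m i \<le> a m (Suc i)" if "i < n" for i
      unfolding a_def using assms(2)[OF that] by (intro nat_mono floor_mono) simp
    from block_sum_coefficients[of n "a m" u, OF this] obtain c where
      c: "\<And>f :: nat \<Rightarrow> real. (\<Sum>i<n. u i * ((\<Sum>j<a m (Suc i). f j) - (\<Sum>j<a m i. f j))) = (\<Sum>j<a m n. c j * f j)"
      "(\<Sum>j<a m n. (c j)\<^sup>2) = (\<Sum>i<n. (u i)\<^sup>2 * (real (a m (Suc i)) - real (a m i)))"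
      by auto
    \<comment> \<open>The dyadic values of the path are known on the good event, so the integrands
      agree almost surely.\<close>
    have "(CLINT g|gauss_seq. iexp (L m g)) = (CLINT g|gauss_seq. iexp (\<Sum>j<a m n. c j * levy_incr g m j))"
    proof (rule integral_cong_AE)
      show "AE g in gauss_seq. iexp (L m g) = iexp (\<Sum>j<a m n. c j * levy_incr g m j)"
        using AE_levy_good
      proof eventually_elim
        case (elim g)
        then show ?case by (simp only: L_def levy_path_dyadic c)
      qed
    qed auto
    also have "\<dots> = exp (- ((\<Sum>j<a m n. (c j)\<^sup>2) / 2 ^ m) / 2)" by (rule char_levy_incr)
    also have "(\<Sum>j<a m n. (c j)\<^sup>2) / 2 ^ m = (\<Sum>i<n. (u i)\<^sup>2 * (real (a m (Suc i)) / 2 ^ m - real (a m i) / 2 ^ m))"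
      unfolding c sum_divide_distrib by (intro sum.cong) (auto simp: diff_divide_distrib right_diff_distrib)
    finally show ?thesis .
  qed
  have "(\<lambda>m. CLINT g|gauss_seq. iexp (L m g)) \<longlonglongrightarrow>
      (CLINT g|gauss_seq. iexp (\<Sum>i<n. u i * (levy_path g (ts (Suc i)) - levy_path g (ts i))))"
  proof (rule integral_dominated_convergence[where w="\<lambda>_. 1"])
    have "(\<lambda>m. iexp (L m g)) \<longlonglongrightarrow> iexp (\<Sum>i<n. u i * (levy_path g (ts (Suc i)) - levy_path g (ts i)))" for g
    proof -
      have "isCont (levy_path g) t" for t
        using continuous_levy_path[of g] by (simp add: continuous_on_eq_continuous_at)
      then have "(\<lambda>m. levy_path g (real (a m i) / 2 ^ m)) \<longlonglongrightarrow> levy_path g (ts i)" if "i \<le> n" for i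
        by (rule isCont_tendsto_compose) (rule a_lim[OF that])
      then have "(\<lambda>m. L m g) \<longlonglongrightarrow> (\<Sum>i<n. u i * (levy_path g (ts (Suc i)) - levy_path g (ts i)))"
        unfolding L_def by (intro tendsto_sum tendsto_mult_left tendsto_diff) auto
      then show ?thesis by (intro tendsto_intros)
    qed
    then show "AE g in gauss_seq. (\<lambda>m. iexp (L m g)) \<longlonglongrightarrow> iexp (\<Sum>i<n. u i * (levy_path g (ts (Suc i)) - levy_path g (ts i)))"
      by simp
  qed auto
  moreover have "(\<lambda>m. CLINT g|gauss_seq. iexp (L m g)) \<longlonglongrightarrow> complex_of_real (exp (- (\<Sum>i<n. (u i)\<^sup>2 * (ts (Suc i) - ts i)) / 2))"
    unfolding E
    by (intro tendsto_of_real tendsto_exp tendsto_divide tendsto_minus tendsto_sum tendsto_mult_left tendsto_diff a_lim tendsto_const) auto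
  ultimately show ?thesis by (rule LIMSEQ_unique)
qed

section \<open>Wiener measure on the path space\<close>

lemma Omega_M_generators: "{{\<omega>\<in>Omega. \<omega> t \<in> U} | t U. 0 \<le> t \<and> U \<in> sets borel} \<subseteq> Pow Omega"
  by auto

lemma space_Omega_M [simp]: "space Omega_M = Omega"
  unfolding Omega_M_def by (simp add: space_measure_of_conv)

lemma sets_Omega_M: "sets Omega_M = sigma_sets Omega {{\<omega>\<in>Omega. \<omega> t \<in> U} | t U. 0 \<le> t \<and> U \<in> sets borel}"
  unfolding Omega_M_def by (rule sets_measure_of[OF Omega_M_generators])

lemma measurable_eval_Omega_M: "(\<lambda>\<omega>. \<omega> t) \<in> borel_measurable Omega_M"
proof (cases "0 \<le> t")
  case True
  show ?thesis
  proof (rule measurableI)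
    fix U :: "real set" assume "U \<in> sets borel"
    then have "{\<omega>\<in>Omega. \<omega> t \<in> U} \<in> sets Omega_M"
      unfolding sets_Omega_M using True by (intro sigma_sets.Basic) blast
    then show "(\<lambda>\<omega>. \<omega> t) -` U \<inter> space Omega_M \<in> sets Omega_M"
      by (simp add: vimage_def Int_def conj_commute)
  qed simp
next
  case False
  then have "(\<lambda>\<omega>. \<omega> t) \<in> borel_measurable Omega_M \<longleftrightarrow> (\<lambda>_. 0 :: real) \<in> borel_measurable Omega_M"
    by (intro measurable_cong) (auto simp: Omega_def)
  then show ?thesis by simp
qed

lemma measurable_into_Omega_M:
  assumes "\<And>x. x \<in> space M \<Longrightarrow> F x \<in> Omega" "\<And>t. 0 \<le> t \<Longrightarrow> (\<lambda>x. F x t) \<in> borel_measurable M"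
  shows "F \<in> measurable M Omega_M"
  unfolding Omega_M_def
proof (rule measurable_measure_of[OF Omega_M_generators])
  show "F \<in> space M \<rightarrow> Omega" using assms by auto
  fix Y assume "Y \<in> {{\<omega>\<in>Omega. \<omega> t \<in> U} | t U. 0 \<le> t \<and> U \<in> sets borel}"
  then obtain t U where Y: "Y = {\<omega>\<in>Omega. \<omega> t \<in> U}" "0 \<le> t" "U \<in> sets borel" by auto
  have "F -` Y \<inter> space M = (\<lambda>x. F x t) -` U \<inter> space M"
    using assms(1) by (auto simp: Y)
  then show "F -` Y \<inter> space M \<in> sets M"
    using measurable_sets[OF assms(2)[OF Y(2)] Y(3)] by simp
qed

text \<open>The witness is the law of \<open>levy_path\<close>. The joint characteristic function of
  its increments factorises into Gaussian ones; a single increment yields the normal law, and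
  several yield independence.\<close>

lemma ex_wiener: "\<exists>Q. wiener Q"
proof -
  define Q where "Q = distr gauss_seq Omega_M levy_path"
  have lm: "levy_path \<in> measurable gauss_seq Omega_M"
    by (rule measurable_into_Omega_M) (auto simp: levy_path_in_Omega measurable_levy_path_at)
  interpret Q: prob_space Q
    unfolding Q_def by (rule gauss_seq.prob_space_distr[OF lm])
  have sQ [measurable_cong]: "sets Q = sets Omega_M" by (simp add: Q_def)
  have ev [measurable]: "(\<lambda>\<omega>. \<omega> t) \<in> borel_measurable Q" for t
    using measurable_eval_Omega_M by (simp add: measurable_cong_sets[OF sQ refl])
  have ch: "(CLINT \<omega>|Q. iexp (\<Sum>i<n. u i * (\<omega> (ts (Suc i)) - \<omega> (ts i)))) =
      (\<Prod>i<n. char (density lborel (\<lambda>x. ennreal (normal_density 0 (sqrt (ts (Suc i) - ts i)) x))) (u i))"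
    if "0 \<le> ts 0" "\<And>i. i < n \<Longrightarrow> ts i < ts (Suc i)" for ts :: "nat \<Rightarrow> real" and n u
  proof -
    have "(CLINT \<omega>|Q. iexp (\<Sum>i<n. u i * (\<omega> (ts (Suc i)) - \<omega> (ts i)))) =
        (CLINT g|gauss_seq. iexp (\<Sum>i<n. u i * (levy_path g (ts (Suc i)) - levy_path g (ts i))))"
      unfolding Q_def
    proof (rule integral_distr[OF lm])
      show "(\<lambda>\<omega>. iexp (\<Sum>i<n. u i * (\<omega> (ts (Suc i)) - \<omega> (ts i)))) \<in> borel_measurable Omega_M"
        using measurable_eval_Omega_M by measurable
    qed
    also have "\<dots> = exp (- (\<Sum>i<n. (u i)\<^sup>2 * (ts (Suc i) - ts i)) / 2)"
      by (rule char_levy_path_increments) (use that in auto)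
    also have "\<dots> = exp (\<Sum>i<n. - ((ts (Suc i) - ts i) * (u i)\<^sup>2) / 2)"
      by (simp add: sum_negf sum_divide_distrib mult.commute)
    also have "\<dots> = (\<Prod>i<n. exp (- ((ts (Suc i) - ts i) * (u i)\<^sup>2) / 2))"
      by (simp add: exp_sum)
    finally show ?thesis
      using that(2) by (simp add: char_normal)
  qed
  have "distributed Q lborel (\<lambda>\<omega>. \<omega> t - \<omega> s) (\<lambda>x. ennreal (normal_density 0 (sqrt (t - s)) x))"
    if st: "0 \<le> s" "s < t" for s t
  proof -
    let ?N = "density lborel (\<lambda>x. ennreal (normal_density 0 (sqrt (t - s)) x))"
    have "distr Q borel (\<lambda>\<omega>. \<omega> t - \<omega> s) = ?N"
    proof (rule distr_eq_of_char[OF Q.prob_space_axioms])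
      fix u
      show "(CLINT \<omega>|Q. iexp (u * (\<omega> t - \<omega> s))) = char ?N u"
        using ch[of "\<lambda>i. if i = 0 then s else t" 1 "\<lambda>_. u"] st by simp
    qed (use st in \<open>auto intro: real_distribution_normal\<close>)
    moreover have "distr Q lborel (\<lambda>\<omega>. \<omega> t - \<omega> s) = distr Q borel (\<lambda>\<omega>. \<omega> t - \<omega> s)"
      by (rule distr_cong) auto
    ultimately show ?thesis
      unfolding distributed_def by auto
  qed
  moreover have "Q.indep_vars (\<lambda>_. borel) (\<lambda>i \<omega>. \<omega> (ts (Suc i)) - \<omega> (ts i)) {..<n}"
    if "0 \<le> ts 0" "\<forall>i<n. ts i < ts (Suc i)" for ts :: "nat \<Rightarrow> real" and n
  proof (rule indep_vars_of_char[OF Q.prob_space_axioms])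
    show "real_distribution (density lborel (\<lambda>x. ennreal (normal_density 0 (sqrt (ts (Suc i) - ts i)) x)))" if "i < n" for i
      using that \<open>\<forall>i<n. _\<close> by (intro real_distribution_normal) simp
    show "(CLINT \<omega>|Q. iexp (\<Sum>i<n. u i * (\<omega> (ts (Suc i)) - \<omega> (ts i)))) =
        (\<Prod>i<n. char (density lborel (\<lambda>x. ennreal (normal_density 0 (sqrt (ts (Suc i) - ts i)) x))) (u i))" for u
      using that by (intro ch) auto
  qed measurable
  ultimately have "wiener Q"
    unfolding wiener_def using sQ Q.prob_space_axioms by auto
  then show ?thesis ..
qed

section \<open>Paths stopped at a level\<close>

definition hit_free :: "real \<Rightarrow> real \<Rightarrow> path \<Rightarrow> bool" where
  "hit_free h t \<omega> \<longleftrightarrow> (\<forall>s\<in>{0..t}. \<omega> s \<noteq> h)"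

text \<open>Inserting \<open>T\<close> truncates the hitting time and keeps \<open>Inf\<close> away from the empty set.\<close>
definition hit_time :: "real \<Rightarrow> real \<Rightarrow> path \<Rightarrow> real" where
  "hit_time h T \<omega> = Inf (insert T {s\<in>{0..T}. \<omega> s = h})"

definition stop_path :: "real \<Rightarrow> real \<Rightarrow> real \<Rightarrow> path \<Rightarrow> path" where
  "stop_path c h T \<omega> = (\<lambda>t. c * \<omega> (min t (hit_time h T \<omega>)))"

text \<open>A feedback control: it is \<open>c\<close> until some grid time finds the level already
  hit. Deciding at the left endpoint of each step keeps it adapted.\<close>

definition hit_integrand :: "real \<Rightarrow> real \<Rightarrow> real \<Rightarrow> nat \<Rightarrow> nat \<Rightarrow> path \<Rightarrow> real" where
  "hit_integrand c h T n k \<omega> = (if hit_free h (real k * T / real n) \<omega> then c else 0)"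

definition stop_approx :: "real \<Rightarrow> real \<Rightarrow> real \<Rightarrow> nat \<Rightarrow> path \<Rightarrow> path" where
  "stop_approx c h T n = stoch_int (hit_integrand c h T n) (\<lambda>k. real k * T / real n) n"

lemma OmegaD:
  assumes "\<omega> \<in> Omega"
  shows "continuous_on {0..} \<omega>" "continuous_on {0..T} \<omega>" "t \<le> 0 \<Longrightarrow> \<omega> t = 0"
  using assms by (auto simp: Omega_def intro: continuous_on_subset)

lemma hit_set_closed:
  assumes "\<omega> \<in> Omega"
  shows "closed (insert T {s\<in>{0..T}. \<omega> s = h})"
proof -
  have "closed ({0..T} \<inter> \<omega> -` {h})"
    using OmegaD(2)[OF assms] by (intro continuous_closed_preimage) auto
  moreover have "{0..T} \<inter> \<omega> -` {h} = {s\<in>{0..T}. \<omega> s = h}" by auto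
  ultimately show ?thesis by (auto intro!: closed_insert)
qed

text \<open>The infimum is attained because the set is closed. The last claim is confined to
  \<open>t < T\<close>, since the inserted \<open>T\<close> also serves as hitting time for paths
  that never hit.\<close>

lemma hit_time:
  assumes "\<omega> \<in> Omega" "0 \<le> T"
  shows "0 \<le> hit_time h T \<omega>" "hit_time h T \<omega> \<le> T"
    and hit_time_hits: "\<not> hit_free h T \<omega> \<Longrightarrow> \<omega> (hit_time h T \<omega>) = h"
    and hit_free_iff: "0 \<le> t \<Longrightarrow> t < T \<Longrightarrow> hit_free h t \<omega> \<longleftrightarrow> t < hit_time h T \<omega>"
proof -
  let ?S = "insert T {s\<in>{0..T}. \<omega> s = h}"
  have bdd: "bdd_below ?S" using assms by (intro bdd_belowI[of _ 0]) auto
  have lower: "hit_time h T \<omega> \<le> s" if "s \<in> ?S" for s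
    unfolding hit_time_def by (rule cInf_lower[OF that bdd])
  have mem: "hit_time h T \<omega> \<in> ?S"
    unfolding hit_time_def by (rule closed_contains_Inf[OF _ bdd hit_set_closed]) (use assms in auto)
  show 0: "0 \<le> hit_time h T \<omega>" "hit_time h T \<omega> \<le> T"
    using mem lower[of T] assms by auto
  show "\<omega> (hit_time h T \<omega>) = h" if hit: "\<not> hit_free h T \<omega>"
  proof (cases "hit_time h T \<omega> = T")
    case True
    \<comment> \<open>No hit can precede the infimum, which is \<open>T\<close> here, so the hit
      occurs at \<open>T\<close> itself.\<close>
    obtain s where s: "s \<in> {0..T}" "\<omega> s = h" using hit unfolding hit_free_def by blast
    then have "s = T" using lower[of s] True by auto
    then show ?thesis using s True by simp
  qed (use mem in auto)
  show "hit_free h t \<omega> \<longleftrightarrow> t < hit_time h T \<omega>" if t: "0 \<le> t" "t < T"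
  proof
    assume free: "hit_free h t \<omega>"
    show "t < hit_time h T \<omega>"
    proof (rule ccontr)
      assume n: "\<not> t < hit_time h T \<omega>"
      then have "\<omega> (hit_time h T \<omega>) = h" using mem t by auto
      then show False using free n 0 by (auto simp: hit_free_def)
    qed
  next
    assume l: "t < hit_time h T \<omega>"
    show "hit_free h t \<omega>"
      unfolding hit_free_def
    proof
      fix s assume s: "s \<in> {0..t}"
      then show "\<omega> s \<noteq> h" using lower[of s] l t by auto
    qed
  qed
qed

lemma stopped_in_Omega:
  assumes "\<omega> \<in> Omega" "0 \<le> s"
  shows "(\<lambda>t. c * \<omega> (min t s)) \<in> Omega"
proof -
  have "continuous_on {0..} (\<lambda>t. \<omega> (min t s))"
    by (rule continuous_on_compose2[OF OmegaD(1)[OF assms(1)]]) (use assms in \<open>auto intro!: continuous_intros\<close>)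
  then show ?thesis
    using assms OmegaD(3)[OF assms(1)] by (auto simp: Omega_def min_def intro!: continuous_intros)
qed

lemma stop_path_in_Omega:
  assumes "\<omega> \<in> Omega" "0 \<le> T"
  shows "stop_path c h T \<omega> \<in> Omega"
  unfolding stop_path_def using assms by (intro stopped_in_Omega hit_time)

text \<open>The control is \<open>c\<close> on an initial run of steps and \<open>0\<close>
  afterwards, so the integral telescopes to the scaled path stopped at the first grid time not
  before the hitting time, less than one mesh later.\<close>

lemma stop_approx_eq:
  assumes "\<omega> \<in> Omega" "0 < T" "0 < n"
  obtains s where "0 \<le> s" "s \<le> T" "\<bar>s - hit_time h T \<omega>\<bar> \<le> T / real n"
    "stop_approx c h T n \<omega> = (\<lambda>t. c * \<omega> (min t s))"
proof -
  let ?\<tau> = "hit_time h T \<omega>"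
  define m where "m = nat \<lceil>?\<tau> * real n / T\<rceil>"
  have \<tau>: "0 \<le> ?\<tau>" "?\<tau> \<le> T" using hit_time[OF assms(1)] assms(2) by auto
  then have nn: "0 \<le> ?\<tau> * real n / T" using assms by simp
  have m: "?\<tau> * real n / T \<le> real m" "real m < ?\<tau> * real n / T + 1"
    using nn unfolding m_def by linarith+
  have m1: "?\<tau> \<le> real m * T / real n" "real m * T / real n < ?\<tau> + T / real n"
    using m assms by (simp_all add: field_simps)
  have "?\<tau> * real n / T \<le> real n"
    using \<tau> assms by (simp add: field_simps)
  then have "real m < real n + 1" using m by linarith
  then have mn: "m \<le> n" by linarith
  have free: "hit_free h (real k * T / real n) \<omega> \<longleftrightarrow> k < m" if "k < n" for k
  proof -
    \<comment> \<open>Grid times with \<open>k < n\<close> lie strictly before \<open>T\<close>, the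
      range in which \<open>hit_free_iff\<close> applies.\<close>
    have "real k * T / real n < T" using that assms by (simp add: field_simps)
    then have "hit_free h (real k * T / real n) \<omega> \<longleftrightarrow> real k * T / real n < ?\<tau>"
      using assms by (intro hit_free_iff) auto
    also have "\<dots> \<longleftrightarrow> real k < ?\<tau> * real n / T" using assms by (simp add: field_simps)
    also have "\<dots> \<longleftrightarrow> k < m" unfolding m_def using nn by linarith
    finally show ?thesis .
  qed
  have "stop_approx c h T n \<omega> t = c * \<omega> (min t (real m * T / real n))" for t
  proof -
    let ?d = "\<lambda>k. \<omega> (min t (real k * T / real n))"
    have "stop_approx c h T n \<omega> t = (\<Sum>k<n. (if k < m then c else 0) * (?d (Suc k) - ?d k))"
      unfolding stop_approx_def stoch_int_def hit_integrand_def
      by (intro sum.cong) (auto simp: free)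
    also have "\<dots> = (\<Sum>k<m. c * (?d (Suc k) - ?d k))"
      by (rule sum.mono_neutral_cong_right) (use mn in auto)
    also have "\<dots> = c * (?d m - ?d 0)"
      using sum_lessThan_telescope[of ?d m] by (simp only: sum_distrib_left[symmetric])
    also have "?d 0 = 0" using OmegaD(3)[OF assms(1)] by simp
    finally show ?thesis by simp
  qed
  moreover have "real m * T / real n \<le> T"
    using mn assms by (simp add: field_simps)
  ultimately show ?thesis
    using that[of "real m * T / real n"] m1 assms by (auto simp: fun_eq_iff abs_le_iff)
qed

lemma stop_approx_in_Omega:
  assumes "\<omega> \<in> Omega" "0 < T" "0 < n"
  shows "stop_approx c h T n \<omega> \<in> Omega"
  by (rule stop_approx_eq[OF assms, of h c]) (simp add: stopped_in_Omega assms(1))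

text \<open>Both sides are the same path stopped at two times at most one mesh apart, so uniform
  continuity on \<open>{0..T}\<close> gives the estimate.\<close>

lemma stop_approx_uniform:
  assumes "\<omega> \<in> Omega" "0 < T" "0 < \<delta>"
  shows "\<forall>\<^sub>F n in sequentially. \<forall>t\<ge>0. \<bar>stop_approx c h T (Suc n) \<omega> t - stop_path c h T \<omega> t\<bar> < \<delta>"
proof -
  have "uniformly_continuous_on {0..T} \<omega>"
    by (rule compact_uniformly_continuous[OF OmegaD(2)[OF assms(1)]]) simp
  \<comment> \<open>The added \<open>1\<close> covers the case \<open>c = 0\<close>.\<close>
  moreover have "0 < \<delta> / (\<bar>c\<bar> + 1)" using assms by simp
  ultimately obtain d where d: "0 < d"
    "\<And>a b. a \<in> {0..T} \<Longrightarrow> b \<in> {0..T} \<Longrightarrow> dist b a < d \<Longrightarrow> dist (\<omega> b) (\<omega> a) < \<delta> / (\<bar>c\<bar> + 1)"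
    unfolding uniformly_continuous_on_def by metis
  have "(\<lambda>n. T / real (Suc n)) \<longlonglongrightarrow> 0"
    by (intro LIMSEQ_Suc lim_const_over_n)
  then have "\<forall>\<^sub>F n in sequentially. T / real (Suc n) < d"
    using d(1) by (rule order_tendstoD)
  then show ?thesis
  proof eventually_elim
    case (elim n)
    let ?\<tau> = "hit_time h T \<omega>"
    obtain s where s: "0 \<le> s" "s \<le> T" "\<bar>s - ?\<tau>\<bar> \<le> T / real (Suc n)"
      "stop_approx c h T (Suc n) \<omega> = (\<lambda>t. c * \<omega> (min t s))"
      using stop_approx_eq[OF assms(1,2), of "Suc n" h c] by auto
    have \<tau>: "0 \<le> ?\<tau>" "?\<tau> \<le> T" using hit_time[OF assms(1)] assms(2) by auto
    show ?case
    proof (intro allI impI)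
      fix t :: real assume "0 \<le> t"
      then have "dist (\<omega> (min t s)) (\<omega> (min t ?\<tau>)) < \<delta> / (\<bar>c\<bar> + 1)"
        using s \<tau> elim by (intro d(2)) (auto simp: dist_real_def)
      then have "\<bar>\<omega> (min t s) - \<omega> (min t ?\<tau>)\<bar> * (\<bar>c\<bar> + 1) < \<delta>"
        by (simp add: dist_real_def pos_less_divide_eq)
      moreover have "\<bar>c * \<omega> (min t s) - c * \<omega> (min t ?\<tau>)\<bar> \<le> \<bar>\<omega> (min t s) - \<omega> (min t ?\<tau>)\<bar> * (\<bar>c\<bar> + 1)"
        by (simp add: abs_mult mult_right_mono mult.commute[of _ "\<bar>c\<bar> + 1"] flip: right_diff_distrib)
      ultimately show "\<bar>stop_approx c h T (Suc n) \<omega> t - stop_path c h T \<omega> t\<bar> < \<delta>"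
        unfolding s(4) stop_path_def by linarith
    qed
  qed
qed

text \<open>This expresses the event through countably many coordinates, which gives its measurability.\<close>
lemma hit_free_iff_dyadic:
  assumes "\<omega> \<in> Omega" "0 \<le> t"
  shows "hit_free h t \<omega> \<longleftrightarrow> (\<exists>m::nat. \<forall>j i. 1 / real (Suc m) \<le> \<bar>\<omega> (t * (real (min i (2 ^ j)) / 2 ^ j)) - h\<bar>)"
proof
  assume free: "hit_free h t \<omega>"
  have "continuous_on {0..t} (\<lambda>s. \<bar>\<omega> s - h\<bar>)"
    using OmegaD(2)[OF assms(1)] by (intro continuous_intros)
  \<comment> \<open>By compactness the distance to \<open>h\<close> has a positive minimum, which
    bounds it from below at all sampled times at once.\<close>
  from continuous_attains_inf[OF _ _ this] obtain s where
    s: "s \<in> {0..t}" "\<And>r. r \<in> {0..t} \<Longrightarrow> \<bar>\<omega> s - h\<bar> \<le> \<bar>\<omega> r - h\<bar>"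
    using assms(2) by auto
  have "0 < \<bar>\<omega> s - h\<bar>" using free s(1) by (auto simp: hit_free_def)
  then obtain m where m: "1 / real (Suc m) < \<bar>\<omega> s - h\<bar>"
    using nat_approx_posE by metis
  show "\<exists>m::nat. \<forall>j i. 1 / real (Suc m) \<le> \<bar>\<omega> (t * (real (min i (2 ^ j)) / 2 ^ j)) - h\<bar>"
  proof (intro exI[of _ m] allI impI)
    fix i' j :: nat
    define i where "i = min i' (2 ^ j)"
    have "i \<le> 2 ^ j" by (simp add: i_def)
    then have "real i \<le> 2 ^ j" by (metis of_nat_le_iff of_nat_numeral of_nat_power)
    then have "real i / 2 ^ j \<le> 1" by simp
    then have "t * (real i / 2 ^ j) \<le> t" "0 \<le> t * (real i / 2 ^ j)"
      using assms(2) by (intro mult_left_le mult_nonneg_nonneg; simp)+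
    then have "t * (real i / 2 ^ j) \<in> {0..t}" by simp
    from s(2)[OF this] m show "1 / real (Suc m) \<le> \<bar>\<omega> (t * (real (min i' (2 ^ j)) / 2 ^ j)) - h\<bar>"
      unfolding i_def by linarith
  qed
next
  assume "\<exists>m::nat. \<forall>j i. 1 / real (Suc m) \<le> \<bar>\<omega> (t * (real (min i (2 ^ j)) / 2 ^ j)) - h\<bar>"
  then obtain m :: nat where m: "\<And>i j. i \<le> 2 ^ j \<Longrightarrow> 1 / real (Suc m) \<le> \<bar>\<omega> (t * (real i / 2 ^ j)) - h\<bar>"
    by (metis min.absorb1)
  show "hit_free h t \<omega>"
    unfolding hit_free_def
  proof (intro ballI notI)
    fix s assume s: "s \<in> {0..t}" and hit: "\<omega> s = h"
    \<comment> \<open>For \<open>t = 0\<close> division by zero gives \<open>r = 0\<close>; since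
      then \<open>s = 0\<close> too, \<open>t * r = s\<close> still holds. Dyadic approximations of
      \<open>r\<close> carry the lower bound over to \<open>s\<close>.\<close>
    define r where "r = s / t"
    have r: "0 \<le> r" "r \<le> 1" "t * r = s" using s by (auto simp: r_def divide_le_eq_1)
    define i where "i j = nat \<lfloor>2 ^ j * r\<rfloor>" for j :: nat
    have i: "i j \<le> 2 ^ j" for j
    proof -
      have "\<lfloor>2 ^ j * r\<rfloor> \<le> 2 ^ j" using r by (simp add: floor_le_iff mult_le_one) (smt (verit) mult_left_le zero_le_power)
      then show ?thesis unfolding i_def by (simp add: nat_le_iff)
    qed
    have "real (i j) \<le> 2 ^ j" for j using i[of j] by (metis of_nat_le_iff of_nat_numeral of_nat_power)
    then have "t * (real (i j) / 2 ^ j) \<le> t" "0 \<le> t * (real (i j) / 2 ^ j)" for j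
      using assms(2) by (intro mult_left_le mult_nonneg_nonneg; simp)+
    then have "t * (real (i j) / 2 ^ j) \<in> {0..t}" for j by simp
    moreover have "(\<lambda>j. t * (real (i j) / 2 ^ j)) \<longlonglongrightarrow> s"
      using tendsto_mult_left[OF dyadic_floor_tendsto[OF r(1)], of t] r(3) by (simp add: i_def)
    ultimately have "(\<lambda>j. \<omega> (t * (real (i j) / 2 ^ j))) \<longlonglongrightarrow> \<omega> s"
      by (intro continuous_on_tendsto_compose[OF OmegaD(2)[OF assms(1), of t] _ s] always_eventually allI)
    then have "(\<lambda>j. \<bar>\<omega> (t * (real (i j) / 2 ^ j)) - h\<bar>) \<longlonglongrightarrow> \<bar>\<omega> s - h\<bar>"
      by (intro tendsto_intros)
    then have "1 / real (Suc m) \<le> \<bar>\<omega> s - h\<bar>"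
      by (rule LIMSEQ_le_const) (use m[OF i] in auto)
    then show False using hit by simp
  qed
qed

section \<open>Adaptedness of the control and measurability of the stopped paths\<close>

lemma space_Filt [simp]: "space (Filt s) = Omega"
  unfolding Filt_def by (simp add: space_measure_of_conv)

lemma sets_Filt: "sets (Filt s) = sigma_sets Omega {{\<omega>\<in>Omega. \<omega> t \<in> U} | t U. 0 \<le> t \<and> t \<le> s \<and> U \<in> sets borel}"
  unfolding Filt_def by (rule sets_measure_of) auto

lemma sets_Filt_subset: "sets (Filt s) \<subseteq> sets Omega_M"
  unfolding sets_Filt sets_Omega_M by (rule sigma_sets_mono') blast

lemma measurable_Filt_Omega_M: "X \<in> measurable (Filt s) N \<Longrightarrow> X \<in> measurable Omega_M N"
  using sets_Filt_subset by (auto simp: measurable_def)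

lemma measurable_eval_Filt:
  assumes "0 \<le> t" "t \<le> s"
  shows "(\<lambda>\<omega>. \<omega> t) \<in> borel_measurable (Filt s)"
proof (rule measurableI)
  fix U :: "real set" assume "U \<in> sets borel"
  then have "{\<omega>\<in>Omega. \<omega> t \<in> U} \<in> sets (Filt s)"
    unfolding sets_Filt using assms by (intro sigma_sets.Basic) blast
  then show "(\<lambda>\<omega>. \<omega> t) -` U \<inter> space (Filt s) \<in> sets (Filt s)"
    by (simp add: vimage_def Int_def conj_commute)
qed simp

lemma hit_free_measurable:
  assumes "0 \<le> t"
  shows "{\<omega>\<in>Omega. hit_free h t \<omega>} \<in> sets (Filt t)"
proof -
  \<comment> \<open>The minimum with \<open>2 ^ j\<close> keeps every sampled time within
    \<open>{0..t}\<close>, so it is observable in \<open>Filt t\<close>.\<close>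
  have [measurable]: "(\<lambda>\<omega>. \<omega> (t * (real (min i (2 ^ j)) / 2 ^ j))) \<in> borel_measurable (Filt t)" for i j
  proof (rule measurable_eval_Filt)
    have "real (min i (2 ^ j)) \<le> 2 ^ j" by (metis min.cobounded2 of_nat_le_iff of_nat_numeral of_nat_power)
    then show "t * (real (min i (2 ^ j)) / 2 ^ j) \<le> t" "0 \<le> t * (real (min i (2 ^ j)) / 2 ^ j)"
      using assms by (intro mult_left_le mult_nonneg_nonneg; simp)+
  qed
  have "{\<omega>\<in>space (Filt t). \<exists>m::nat. \<forall>j i. 1 / real (Suc m) \<le> \<bar>\<omega> (t * (real (min i (2 ^ j)) / 2 ^ j)) - h\<bar>} \<in> sets (Filt t)"
    by measurable
  also have "{\<omega>\<in>space (Filt t). \<exists>m::nat. \<forall>j i. 1 / real (Suc m) \<le> \<bar>\<omega> (t * (real (min i (2 ^ j)) / 2 ^ j)) - h\<bar>} =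
      {\<omega>\<in>Omega. hit_free h t \<omega>}"
    by (rule Collect_cong) (simp add: hit_free_iff_dyadic[OF _ assms] cong: conj_cong)
  finally show ?thesis .
qed

lemma hit_integrand_measurable:
  assumes "0 < T"
  shows "hit_integrand c h T n k \<in> borel_measurable (Filt (real k * T / real n))"
proof -
  have "Measurable.pred (Filt (real k * T / real n)) (hit_free h (real k * T / real n))"
    using hit_free_measurable[of "real k * T / real n" h] assms by (simp add: pred_def)
  then show ?thesis unfolding hit_integrand_def by measurable
qed

lemma measurable_stop_approx:
  assumes "0 < T" "0 < n"
  shows "stop_approx c h T n \<in> measurable Omega_M Omega_M"
proof (rule measurable_into_Omega_M)
  fix t :: real
  have [measurable]: "hit_integrand c h T n k \<in> borel_measurable Omega_M" for k
    using hit_integrand_measurable[OF assms(1)] by (rule measurable_Filt_Omega_M)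
  note [measurable] = measurable_eval_Omega_M
  show "(\<lambda>\<omega>. stop_approx c h T n \<omega> t) \<in> borel_measurable Omega_M"
    unfolding stop_approx_def stoch_int_def by measurable
qed (simp add: stop_approx_in_Omega assms)

text \<open>The stopped path is a pointwise limit of finite sums of measurable terms, so its
  dependence on the hitting time calls for no separate argument.\<close>

lemma measurable_stop_path:
  assumes "0 < T"
  shows "stop_path c h T \<in> measurable Omega_M Omega_M"
proof (rule measurable_into_Omega_M)
  fix t :: real assume t: "0 \<le> t"
  show "(\<lambda>\<omega>. stop_path c h T \<omega> t) \<in> borel_measurable Omega_M"
  proof (rule borel_measurable_LIMSEQ_real)
    fix \<omega> assume \<omega>: "\<omega> \<in> space Omega_M"
    show "(\<lambda>n. stop_approx c h T (Suc n) \<omega> t) \<longlonglongrightarrow> stop_path c h T \<omega> t"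
      unfolding tendsto_iff dist_real_def
      by (intro allI impI, rule eventually_mono[OF stop_approx_uniform[of \<omega> T _ c h]]) (use assms t \<omega> in auto)
  next
    fix n
    show "(\<lambda>\<omega>. stop_approx c h T (Suc n) \<omega> t) \<in> borel_measurable Omega_M"
      using measurable_compose[OF measurable_stop_approx[OF assms] measurable_eval_Omega_M] by simp
  qed
qed (use assms in \<open>simp add: stop_path_in_Omega\<close>)

section \<open>Stopped laws as weak limits of simple laws, and positivity of the hitting
  probability\<close>

lemma cont_on_Omega_tendsto:
  assumes "cont_on_Omega F X" "p \<in> F" "\<And>n. p' n \<in> F" "F \<subseteq> Omega"
    and "\<And>\<delta>. 0 < \<delta> \<Longrightarrow> \<forall>\<^sub>F n in sequentially. \<forall>t\<ge>0. \<bar>p' n t - p t\<bar> < \<delta>"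
  shows "(\<lambda>n. X (p' n)) \<longlonglongrightarrow> X p"
  unfolding tendsto_iff dist_real_def
proof (intro allI impI)
  fix e :: real assume "0 < e"
  then obtain N \<delta> where "0 < \<delta>" "\<And>\<omega>'. \<omega>' \<in> F \<inter> nbhd p N \<delta> \<Longrightarrow> \<bar>X \<omega>' - X p\<bar> < e"
    using assms(1,2) unfolding cont_on_Omega_def by blast
  moreover have "p' n \<in> F \<inter> nbhd p N \<delta>" if "\<forall>t\<ge>0. \<bar>p' n t - p t\<bar> < \<delta>" for n
    using assms(3)[of n] assms(4) that by (auto simp: nbhd_def)
  ultimately show "\<forall>\<^sub>F n in sequentially. \<bar>X (p' n) - X p\<bar> < e"
    using assms(5)[of \<delta>] by (auto elim: eventually_mono)
qed

text \<open>Here the degenerate lower volatility enters: the controls take only the values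
  \<open>0\<close> and \<open>c\<close>, both in \<open>{0..\<sigma>}\<close>, so the approximations
  have simple laws. Uniform convergence of their paths gives weak convergence by dominated
  convergence.\<close>

lemma distr_stop_path_in_PG:
  assumes Q: "wiener Q" and c: "0 \<le> c" "c \<le> \<sigma>" and T: "0 < T"
  shows "distr Q Omega_M (stop_path c h T) \<in> PG \<sigma>"
proof -
  interpret prob_space Q using Q by (simp add: wiener_def)
  have sQ [measurable_cong]: "sets Q = sets Omega_M" using Q by (simp add: wiener_def)
  have spQ: "space Q = Omega" using sets_eq_imp_space_eq[OF sQ] by simp
  have mp: "stop_path c h T \<in> measurable Q Omega_M"
    using measurable_stop_path[OF T] by (simp add: measurable_cong_sets[OF sQ refl])
  have ma: "stop_approx c h T (Suc n) \<in> measurable Q Omega_M" for n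
    using measurable_stop_approx[OF T] by (simp add: measurable_cong_sets[OF sQ refl])
  define Pn where "Pn n = distr Q Omega_M (stop_approx c h T (Suc n))" for n
  have "Pn n \<in> simple_laws \<sigma>" for n
    unfolding simple_laws_def
  proof (rule CollectI, rule exI[of _ Q], rule exI[of _ "hit_integrand c h T (Suc n)"],
      rule exI[of _ "\<lambda>k. real k * T / real (Suc n)"], rule exI[of _ "Suc n"], intro conjI)
    show "Pn n = distr Q Omega_M (stoch_int (hit_integrand c h T (Suc n)) (\<lambda>k. real k * T / real (Suc n)) (Suc n))"
      by (simp only: Pn_def stop_approx_def)
    show "\<forall>k<Suc n. real k * T / real (Suc n) < real (Suc k) * T / real (Suc n)"
      using T by (auto intro!: divide_strict_right_mono)
    show "\<forall>k<Suc n. hit_integrand c h T (Suc n) k \<in> borel_measurable (Filt (real k * T / real (Suc n))) \<and>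
        (\<forall>\<omega>\<in>Omega. hit_integrand c h T (Suc n) k \<omega> \<in> {0..\<sigma>})"
      using hit_integrand_measurable[OF T] c by (auto simp: hit_integrand_def simp del: of_nat_Suc)
  qed (use Q in auto)
  moreover have "weak_conv Pn (distr Q Omega_M (stop_path c h T))"
    unfolding weak_conv_def
  proof (intro allI impI)
    fix f assume f: "bounded_cont_Omega f"
    then obtain K where K: "\<And>\<omega>. \<omega> \<in> Omega \<Longrightarrow> \<bar>f \<omega>\<bar> \<le> K" by (auto simp: bounded_cont_Omega_def)
    show "(\<lambda>n. \<integral>\<omega>. f \<omega> \<partial>Pn n) \<longlonglongrightarrow> (\<integral>\<omega>. f \<omega> \<partial>distr Q Omega_M (stop_path c h T))"
    \<comment> \<open>\<open>weak_conv\<close> ranges over all bounded continuous functionals;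
      measurability is settled by cases instead of being derived from continuity.\<close>
    proof (cases "f \<in> borel_measurable Omega_M")
      case True
      have "(\<lambda>n. \<integral>\<omega>. f (stop_approx c h T (Suc n) \<omega>) \<partial>Q) \<longlonglongrightarrow> (\<integral>\<omega>. f (stop_path c h T \<omega>) \<partial>Q)"
      proof (rule integral_dominated_convergence[where w="\<lambda>_. K"])
        show "AE \<omega> in Q. (\<lambda>n. f (stop_approx c h T (Suc n) \<omega>)) \<longlonglongrightarrow> f (stop_path c h T \<omega>)"
        proof (rule AE_I2)
          fix \<omega> assume "\<omega> \<in> space Q"
          then have \<omega>: "\<omega> \<in> Omega" by (simp add: spQ)
          show "(\<lambda>n. f (stop_approx c h T (Suc n) \<omega>)) \<longlonglongrightarrow> f (stop_path c h T \<omega>)"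
            by (rule cont_on_Omega_tendsto[where F=Omega and p="stop_path c h T \<omega>"
                  and p'="\<lambda>n. stop_approx c h T (Suc n) \<omega>"])
               (use f \<omega> T in \<open>auto simp: bounded_cont_Omega_def stop_approx_in_Omega stop_path_in_Omega stop_approx_uniform\<close>)
        qed
        show "AE \<omega> in Q. norm (f (stop_approx c h T (Suc n) \<omega>)) \<le> K" for n
          using K T by (intro AE_I2) (simp add: spQ stop_approx_in_Omega)
      qed (use measurable_compose[OF mp True] measurable_compose[OF ma True] in auto)
      then show ?thesis
        unfolding Pn_def by (simp add: integral_distr[OF ma True] integral_distr[OF mp True])
    next
      case False
      txt \<open>For non-measurable \<open>f\<close> all integrals are \<open>0\<close> by convention.\<close>
      have "integral\<^sup>L (distr Q Omega_M F) f = 0" for F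
        by (rule not_integrable_integral_eq) (use False borel_measurable_integrable in fastforce)
      then show ?thesis by (simp add: Pn_def)
    qed
  qed
  ultimately show ?thesis
    unfolding PG_def using prob_space_distr[OF mp] by auto
qed

text \<open>By the intermediate value theorem a path that ends beyond \<open>h\<close>, as seen from
  \<open>0\<close>, has hit \<open>h\<close>. The Gaussian density is positive on the unit interval
  \<open>H\<close> beyond \<open>h\<close>, so such endings have positive probability.\<close>

lemma wiener_hit_pos:
  assumes Q: "wiener Q" and T: "0 < T"
  shows "0 < measure Q {\<omega>\<in>Omega. \<not> hit_free h T \<omega>}"
proof -
  interpret prob_space Q using Q by (simp add: wiener_def)
  have sQ [measurable_cong]: "sets Q = sets Omega_M" using Q by (simp add: wiener_def)
  have spQ: "space Q = Omega" using sets_eq_imp_space_eq[OF sQ] by simp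
  define H where "H = (if 0 \<le> h then {h<..<h + 1} else {h - 1<..<h})"
  have H: "H \<in> sets borel" "emeasure lborel H = 1" by (auto simp: H_def)
  have dist: "distributed Q lborel (\<lambda>\<omega>. \<omega> T - \<omega> 0) (\<lambda>x. ennreal (normal_density 0 (sqrt T) x))"
  proof -
    have "\<forall>s t. 0 \<le> s \<and> s < t \<longrightarrow>
        distributed Q lborel (\<lambda>\<omega>. \<omega> t - \<omega> s) (\<lambda>x. ennreal (normal_density 0 (sqrt (t - s)) x))"
      using Q unfolding wiener_def by (elim conjE)
    from this[rule_format, of 0 T] T show ?thesis by simp
  qed
  let ?D = "(\<lambda>\<omega>. \<omega> T - \<omega> 0) -` H \<inter> space Q"
  have "emeasure Q ?D \<noteq> 0"
  proof
    assume "emeasure Q ?D = 0"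
    then have "(\<integral>\<^sup>+x. ennreal (normal_density 0 (sqrt T) x) * indicator H x \<partial>lborel) = 0"
      using distributed_emeasure[OF dist, of H] H by simp
    then have "AE x in lborel. ennreal (normal_density 0 (sqrt T) x) * indicator H x = 0"
      using H by (subst (asm) nn_integral_0_iff_AE) auto
    then have "AE x in lborel. x \<notin> H"
    proof eventually_elim
      case (elim x)
      then show ?case
        using normal_density_pos[of "sqrt T" 0 x] T by (auto simp: indicator_def split: if_splits)
    qed
    then have "emeasure lborel H = 0"
      using H by (subst (asm) AE_iff_measurable[of H]) auto
    then show False using H by simp
  qed
  then have "0 < measure Q ?D" by (simp add: emeasure_eq_measure zero_less_measure_iff)
  also have "measure Q ?D \<le> measure Q {\<omega>\<in>Omega. \<not> hit_free h T \<omega>}"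
  proof (rule finite_measure_mono)
    have "{\<omega>\<in>Omega. hit_free h T \<omega>} \<in> sets Q"
      using hit_free_measurable[of T h] sets_Filt_subset T sQ by auto
    then have "space Q - {\<omega>\<in>Omega. hit_free h T \<omega>} \<in> sets Q" by auto
    also have "space Q - {\<omega>\<in>Omega. hit_free h T \<omega>} = {\<omega>\<in>Omega. \<not> hit_free h T \<omega>}" by (auto simp: spQ)
    finally show "{\<omega>\<in>Omega. \<not> hit_free h T \<omega>} \<in> sets Q" .
    show "?D \<subseteq> {\<omega>\<in>Omega. \<not> hit_free h T \<omega>}"
    proof
      fix \<omega> assume "\<omega> \<in> ?D"
      then have \<omega>: "\<omega> \<in> Omega" and "\<omega> T - \<omega> 0 \<in> H" by (auto simp: spQ)
      then have HT: "\<omega> T \<in> H" "\<omega> 0 = 0" using OmegaD(3)[OF \<omega>, of 0] by auto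
      have "\<exists>s\<ge>0. s \<le> T \<and> \<omega> s = h"
      proof (cases "0 \<le> h")
        case True
        then show ?thesis using IVT'[of \<omega> 0 h T] HT T OmegaD(2)[OF \<omega>] by (auto simp: H_def)
      next
        case False
        then show ?thesis using IVT2'[of \<omega> T h 0] HT T OmegaD(2)[OF \<omega>] by (auto simp: H_def)
      qed
      then show "\<omega> \<in> {\<omega>\<in>Omega. \<not> hit_free h T \<omega>}" using \<omega> by (auto simp: hit_free_def)
    qed
  qed
  finally show ?thesis .
qed

section \<open>Jumps of the indicator along a segment, and the contradiction\<close>

text \<open>A continuous indicator with different values at \<open>0\<close> and \<open>1\<close>
  would attain \<open>1/2\<close> in between. So there is a discontinuity \<open>t\<close>, and
  points near it with the other value form the sequence.\<close>

lemma ex_jump_sequence: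
  fixes B :: "real set"
  assumes "(1 \<in> B) \<noteq> (0 \<in> B)"
  obtains t r where "t \<in> {0..1}" "\<And>n :: nat. r n \<in> {0..1}" "r \<longlonglongrightarrow> t" "\<And>n. (r n \<in> B) \<noteq> (t \<in> B)"
proof -
  define \<phi> :: "real \<Rightarrow> real" where "\<phi> = indicator B"
  have val: "\<phi> s = 0 \<or> \<phi> s = 1" for s by (auto simp: \<phi>_def indicator_def)
  have "\<not> continuous_on {0..1} \<phi>"
  proof
    assume c: "continuous_on {0..1} \<phi>"
    have "\<exists>s\<ge>0. s \<le> 1 \<and> \<phi> s = 1/2"
    proof (cases "0 \<in> B")
      case True
      then show ?thesis using assms by (intro IVT2' c) (auto simp: \<phi>_def)
    next
      case False
      then show ?thesis using assms by (intro IVT' c) (auto simp: \<phi>_def)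
    qed
    then obtain s where "\<phi> s = 1/2" by auto
    with val[of s] show False by auto
  qed
  then obtain t e where t: "t \<in> {0..1}" "0 < e" "\<And>d. 0 < d \<Longrightarrow> \<exists>s\<in>{0..1}. dist s t < d \<and> \<not> dist (\<phi> s) (\<phi> t) < e"
    unfolding continuous_on_iff by blast
  have "\<forall>n. \<exists>s. s \<in> {0..1} \<and> dist s t < 1 / real (Suc n) \<and> (s \<in> B) \<noteq> (t \<in> B)"
  proof
    fix n
    obtain s where s: "s \<in> {0..1}" "dist s t < 1 / real (Suc n)" "\<not> dist (\<phi> s) (\<phi> t) < e"
      using t(3)[of "1 / real (Suc n)"] by auto
    then have "\<phi> s \<noteq> \<phi> t" using t(2) by auto
    then have "(s \<in> B) \<noteq> (t \<in> B)" by (auto simp: \<phi>_def indicator_def split: if_splits)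
    with s show "\<exists>s. s \<in> {0..1} \<and> dist s t < 1 / real (Suc n) \<and> (s \<in> B) \<noteq> (t \<in> B)" by blast
  qed
  then obtain r where r: "\<And>n. r n \<in> {0..1}" "\<And>n. dist (r n) t < 1 / real (Suc n)" "\<And>n. (r n \<in> B) \<noteq> (t \<in> B)"
    by metis
  have "(\<lambda>n. r n - t) \<longlonglongrightarrow> 0"
  proof (rule Lim_null_comparison)
    show "\<forall>\<^sub>F n in sequentially. norm (r n - t) \<le> 1 / real (Suc n)"
      using r(2) by (auto simp: dist_real_def less_imp_le intro!: always_eventually)
    show "(\<lambda>n. 1 / real (Suc n)) \<longlonglongrightarrow> 0" by (rule LIMSEQ_Suc[OF lim_const_over_n])
  qed
  then have "r \<longlonglongrightarrow> t" by (rule LIM_zero_cancel)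
  then show ?thesis using that t(1) r by blast
qed

text \<open>Continuity from above along the decreasing tail unions, each of which contains one of
  the sets and so has measure at least \<open>b\<close>.\<close>

lemma (in finite_measure) measure_limsup_ge:
  assumes G: "\<And>n :: nat. G n \<in> sets M" and "\<And>n. b \<le> measure M (G n)"
  shows "b \<le> measure M (\<Inter>m. \<Union>n\<in>{m..}. G n)"
proof (rule LIMSEQ_le_const)
  show "(\<lambda>m. measure M (\<Union>n\<in>{m..}. G n)) \<longlonglongrightarrow> measure M (\<Inter>m. \<Union>n\<in>{m..}. G n)"
  proof (rule finite_Lim_measure_decseq)
    show "range (\<lambda>m. \<Union>n\<in>{m..}. G n) \<subseteq> sets M"
      using G by (auto intro!: sets.countable_UN')
    show "decseq (\<lambda>m. \<Union>n\<in>{m..}. G n)"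
      unfolding decseq_def by (intro allI impI UN_mono) auto
  qed
  show "\<exists>N. \<forall>m\<ge>N. b \<le> measure M (\<Union>n\<in>{m..}. G n)"
  proof (intro exI allI impI)
    fix m
    have "measure M (G m) \<le> measure M (\<Union>n\<in>{m..}. G n)"
      by (rule finite_measure_mono) (use G in \<open>auto intro!: sets.countable_UN'\<close>)
    then show "b \<le> measure M (\<Union>n\<in>{m..}. G n)" using assms(2)[of m] by linarith
  qed
qed

theorem theorem4p1:
  fixes \<sigma> T :: real and A :: "real set"
  assumes "\<sigma> > 0" and "T > 0" and "A \<in> sets borel" and "A \<noteq> {}" and "A \<noteq> UNIV"
  shows "(\<lambda>\<omega>. indicator A (\<omega> T)) \<notin> L1G \<sigma>"
proof
  assume "(\<lambda>\<omega>. indicator A (\<omega> T)) \<in> L1G \<sigma>"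
  then obtain Y where Y: "quasi_continuous \<sigma> Y" "qs_null \<sigma> {\<omega>. indicator A (\<omega> T) \<noteq> Y \<omega>}"
    by (auto simp: L1G_def)
  obtain N where N: "N \<in> sets Omega_M" "{\<omega>. indicator A (\<omega> T) \<noteq> Y \<omega>} \<inter> Omega \<subseteq> N" "cap \<sigma> N = 0"
    using Y(2) by (auto simp: qs_null_def)
  obtain x where x: "(x \<in> A) \<noteq> (0 \<in> A)"
    using assms(4,5) by auto
  \<comment> \<open>The level is chosen so that scaling by \<open>\<sigma>\<close> sends it to
    \<open>x\<close>.\<close>
  define h where "h = x / \<sigma>"
  obtain t r where t: "t \<in> {0..1}" and r: "\<And>n :: nat. r n \<in> {0..1}" "r \<longlonglongrightarrow> t"
    and jump: "\<And>n. (r n * x \<in> A) \<noteq> (t * x \<in> A)"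
    using ex_jump_sequence[of "{s. s * x \<in> A}"] x by auto
  obtain Q where Q: "wiener Q" using ex_wiener by blast
  interpret prob_space Q using Q by (simp add: wiener_def)
  have sQ: "sets Q = sets Omega_M" using Q by (simp add: wiener_def)
  have spQ: "space Q = Omega" using sets_eq_imp_space_eq[OF sQ] by simp
  define E where "E = {\<omega>\<in>Omega. \<not> hit_free h T \<omega>}"
  define p where "p = measure Q E"
  have p: "0 < p" unfolding p_def E_def by (rule wiener_hit_pos[OF Q assms(2)])
  \<comment> \<open>Sets outside the sigma-algebra have measure \<open>0\<close> by default, so
    positivity already gives measurability.\<close>
  then have Es: "E \<in> sets Q" using measure_notin_sets[of E Q] by (auto simp: p_def)
  \<comment> \<open>With the threshold \<open>p / 4\<close>, the limit superior \<open>L\<close>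
    below keeps mass at least \<open>3 * p / 4\<close>, more than the mass of at most
    \<open>p / 4\<close> that is bad for the parameter \<open>t\<close>.\<close>
  obtain U where U: "U \<in> sets Omega_M" "cap \<sigma> U < ennreal (p / 4)" "cont_on_Omega (Omega - U) Y"
    using Y(1) p unfolding quasi_continuous_def by (metis divide_pos_pos zero_less_numeral)
  define Z where "Z s = stop_path (s * \<sigma>) h T" for s
  \<comment> \<open>Avoiding \<open>N\<close> as well as \<open>U\<close> ensures that
    \<open>Y\<close> agrees with the indicator along the path.\<close>
  define Bad where "Bad s = {\<omega>\<in>Omega. Z s \<omega> \<in> U \<union> N}" for s
  have Zm: "Z s \<in> measurable Q Omega_M" for s
    unfolding Z_def using measurable_stop_path[OF assms(2)] by (simp add: measurable_cong_sets[OF sQ refl])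
  have Z_in: "Z s \<omega> \<in> Omega" if "\<omega> \<in> Omega" for s \<omega>
    unfolding Z_def using that assms(2) by (simp add: stop_path_in_Omega)
  have Bad_eq: "Bad s = Z s -` (U \<union> N) \<inter> space Q" for s by (auto simp: Bad_def spQ)
  have Bads: "Bad s \<in> sets Q" for s
    unfolding Bad_eq using U(1) N(1) by (intro measurable_sets[OF Zm]) auto
  have Bad_le: "measure Q (Bad s) \<le> p / 4" if "s \<in> {0..1}" for s
  proof -
    have "distr Q Omega_M (Z s) \<in> PG \<sigma>"
      unfolding Z_def using that assms(1,2)
      by (intro distr_stop_path_in_PG Q) (auto simp: mult_le_cancel_right1)
    then have le: "emeasure (distr Q Omega_M (Z s)) D \<le> cap \<sigma> D" for D
      unfolding cap_def by (rule SUP_upper)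
    have "emeasure Q (Bad s) = emeasure (distr Q Omega_M (Z s)) (U \<union> N)"
      unfolding Bad_eq using U(1) N(1) by (subst emeasure_distr[OF Zm]) auto
    also have "\<dots> \<le> emeasure (distr Q Omega_M (Z s)) U + emeasure (distr Q Omega_M (Z s)) N"
      using U(1) N(1) by (intro emeasure_subadditive) auto
    also have "\<dots> \<le> ennreal (p / 4) + 0"
      using le[of U] le[of N] U(2) N(3) by (intro add_mono) auto
    finally show ?thesis using p by (simp add: emeasure_eq_measure)
  qed
  \<comment> \<open>On \<open>E\<close> the path has reached the level by time \<open>T\<close> and
    is frozen there, so its value at \<open>T\<close> is the deterministic number
    \<open>s * x\<close>.\<close>
  have good: "Y (Z s \<omega>) = indicator A (s * x)" if "\<omega> \<in> E - Bad s" for s \<omega>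
  proof -
    have \<omega>: "\<omega> \<in> Omega" "\<not> hit_free h T \<omega>" "Z s \<omega> \<notin> N" using that by (auto simp: E_def Bad_def)
    have "min T (hit_time h T \<omega>) = hit_time h T \<omega>"
      using hit_time(2)[OF \<omega>(1), of T h] assms(2) by simp
    then have "Z s \<omega> T = s * \<sigma> * h"
      unfolding Z_def stop_path_def using hit_time_hits[OF \<omega>(1) _ \<omega>(2)] assms(2) by simp
    also have "\<dots> = s * x" using assms(1) by (simp add: h_def)
    finally have "Z s \<omega> T = s * x" .
    moreover have "indicator A (Z s \<omega> T) = Y (Z s \<omega>)"
      using N(2) \<omega>(3) Z_in[OF \<omega>(1), of s] by blast
    ultimately show ?thesis by simp
  qed
  \<comment> \<open>For each \<open>\<omega>\<close> in \<open>L\<close> infinitely many parameters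
    \<open>r n\<close> are good; which ones may depend on \<open>\<omega>\<close>.\<close>
  define L where "L = (\<Inter>m. \<Union>n\<in>{m..}. E - Bad (r n))"
  have "p - p / 4 \<le> measure Q L"
    unfolding L_def
  proof (rule measure_limsup_ge)
    fix n
    show "E - Bad (r n) \<in> sets Q" using Es Bads by auto
    have "measure Q E - measure Q (Bad (r n)) \<le> measure Q (E - Bad (r n))"
      using finite_measure_Diff'[OF Es Bads, of "r n"] finite_measure_mono[OF Int_lower2 Bads, of E "r n"]
      by linarith
    then show "p - p / 4 \<le> measure Q (E - Bad (r n))"
      using Bad_le[OF r(1)[of n]] by (simp add: p_def)
  qed
  then have "measure Q (Bad t) < measure Q L" using Bad_le[OF t] p by linarith
  then have "\<not> L \<subseteq> Bad t" using finite_measure_mono[OF _ Bads, of L t] by auto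
  then obtain \<omega> where \<omega>: "\<omega> \<in> L" "\<omega> \<notin> Bad t" by blast
  have \<omega>E: "\<omega> \<in> E" using \<omega>(1) by (auto simp: L_def)
  then have \<omega>O: "\<omega> \<in> Omega" by (simp add: E_def)
  have "Z t \<omega> \<in> Omega - U" using Z_in[OF \<omega>O] \<omega>(2) \<omega>O by (auto simp: Bad_def)
  \<comment> \<open>Tolerance \<open>1\<close> is enough, since the values to be compared are
    distinct elements of \<open>{0, 1}\<close>.\<close>
  then obtain k \<delta> where \<delta>: "0 < \<delta>" "\<And>\<omega>'. \<omega>' \<in> (Omega - U) \<inter> nbhd (Z t \<omega>) k \<delta> \<Longrightarrow> \<bar>Y \<omega>' - Y (Z t \<omega>)\<bar> < 1"
    using U(3) unfolding cont_on_Omega_def by (metis zero_less_one)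
  have "bounded (\<omega> ` {0..T})"
    by (intro compact_imp_bounded compact_continuous_image OmegaD(2)[OF \<omega>O]) simp
  \<comment> \<open>Stopping by time \<open>T\<close> involves only values of
    \<open>\<omega>\<close> on \<open>{0..T}\<close>, so one bound \<open>b\<close> makes
    \<open>Z (r n) \<omega>\<close> close to \<open>Z t \<omega>\<close> uniformly in time.\<close>
  then obtain b where b: "\<And>s. s \<in> {0..T} \<Longrightarrow> \<bar>\<omega> s\<bar> \<le> b" "0 < b"
    unfolding bounded_pos by fastforce
  have "(\<lambda>n. \<bar>r n - t\<bar> * (\<sigma> * b)) \<longlonglongrightarrow> \<bar>t - t\<bar> * (\<sigma> * b)"
    by (intro tendsto_intros r)
  then have "\<forall>\<^sub>F n in sequentially. \<bar>r n - t\<bar> * (\<sigma> * b) < \<delta>"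
    by (rule order_tendstoD) (use \<delta> in simp)
  then obtain m where m: "\<And>n. m \<le> n \<Longrightarrow> \<bar>r n - t\<bar> * (\<sigma> * b) < \<delta>"
    by (auto simp: eventually_sequentially)
  obtain n where n: "m \<le> n" "\<omega> \<in> E - Bad (r n)" using \<omega>(1) by (auto simp: L_def)
  have "Z (r n) \<omega> \<in> nbhd (Z t \<omega>) k \<delta>"
    unfolding nbhd_def
  proof (intro CollectI conjI ballI Z_in \<omega>O)
    fix s assume "s \<in> {0..real k}"
    let ?v = "\<omega> (min s (hit_time h T \<omega>))"
    have "min s (hit_time h T \<omega>) \<in> {0..T}"
      using \<open>s \<in> _\<close> hit_time(1,2)[OF \<omega>O, of T h] assms(2) by auto
    then have "\<bar>?v\<bar> \<le> b" by (rule b)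
    have "\<bar>Z (r n) \<omega> s - Z t \<omega> s\<bar> = \<bar>r n - t\<bar> * (\<sigma> * \<bar>?v\<bar>)"
      unfolding Z_def stop_path_def using assms(1) by (simp add: left_diff_distrib[symmetric] abs_mult)
    also have "\<dots> \<le> \<bar>r n - t\<bar> * (\<sigma> * b)"
      using \<open>\<bar>?v\<bar> \<le> b\<close> assms(1) by (intro mult_left_mono) auto
    also have "\<dots> < \<delta>" by (rule m[OF n(1)])
    finally show "\<bar>Z (r n) \<omega> s - Z t \<omega> s\<bar> < \<delta>" .
  qed
  moreover have "Z (r n) \<omega> \<in> Omega - U" using Z_in[OF \<omega>O] n(2) \<omega>O by (auto simp: Bad_def)
  ultimately have "\<bar>Y (Z (r n) \<omega>) - Y (Z t \<omega>)\<bar> < 1" by (intro \<delta>) auto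
  then show False
    using good[OF n(2)] good[of \<omega> t] \<omega>(2) \<omega>E jump[of n] by (auto simp: indicator_def split: if_splits)
qed

end
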